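(* The first Tjurina number $\tau^1$ is not a topological invariant of germs of plane curves. More precisely, for $f(x,y)=y^3-x^7$ and $g(x,y)=y^3-x^7+x^5y$ there exists a germ of homeomorphism $\phi:(\mathbb{C}^2,0)\to(\mathbb{C}^2,0)$ with $\phi(\{f=0\})=\{g=0\}$, but $\tau^1(f)=14$ and $\tau^1(g)=13$.
   Context: $\mathcal{O}_2=\mathbb{C}\{x,y\}$ is the ring of germs of holomorphic functions at $0\in\mathbb{C}^2$ and $\mathfrak{m}$ is its maximal ideal. For $f\in\mathcal{O}_2$ with an isolated singularity, $j(f)=\langle f_x,f_y\rangle$, and $k\ge0$, the $k$-th Tjurina number is $\tau^k(f)=\dim_{\mathbb{C}}\mathcal{O}_2/(\mathfrak{m}^k j(f)+\langle f\rangle)$. *)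

theory Defs
  imports
    "HOL-Analysis.Analysis"
    "HOL-Library.Extended_Nat"
    "HOL-Algebra.Embedded_Algebras"
    "HOL-Algebra.Ideal_Product"
    "HOL-Algebra.QuotRing"
begin

section \<open>Germs of functions at the origin of \<open>\<complex>\<^sup>2\<close>\<close>

text \<open>The type \<open>fgerm\<close> contains the germs of arbitrary functions; the holomorphic ones are
  singled out below as the carrier of the ring \<open>\<O>\<^sub>2\<close>.\<close>

quotient_type fgerm = "complex \<times> complex \<Rightarrow> complex" /
  "\<lambda>f g. eventually (\<lambda>p. f p = g p) (nhds 0)"
  morphisms germ_rep germ
proof (rule equivpI)
  show "reflp (\<lambda>f g :: complex \<times> complex \<Rightarrow> complex. eventually (\<lambda>p. f p = g p) (nhds 0))"
    by (rule reflpI) simp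
  show "symp (\<lambda>f g :: complex \<times> complex \<Rightarrow> complex. eventually (\<lambda>p. f p = g p) (nhds 0))"
    by (rule sympI) (simp add: eq_commute)
  show "transp (\<lambda>f g :: complex \<times> complex \<Rightarrow> complex. eventually (\<lambda>p. f p = g p) (nhds 0))"
    by (rule transpI) (erule (1) eventually_elim2, simp)
qed

instantiation fgerm :: comm_ring_1
begin

lift_definition zero_fgerm :: fgerm is "\<lambda>p. 0" .

lift_definition one_fgerm :: fgerm is "\<lambda>p. 1" .

lift_definition plus_fgerm :: "fgerm \<Rightarrow> fgerm \<Rightarrow> fgerm" is "\<lambda>f g p. f p + g p"
  by (erule (1) eventually_elim2) simp

lift_definition minus_fgerm :: "fgerm \<Rightarrow> fgerm \<Rightarrow> fgerm" is "\<lambda>f g p. f p - g p"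
  by (erule (1) eventually_elim2) simp

lift_definition uminus_fgerm :: "fgerm \<Rightarrow> fgerm" is "\<lambda>f p. - f p"
  by (erule eventually_mono) simp

lift_definition times_fgerm :: "fgerm \<Rightarrow> fgerm \<Rightarrow> fgerm" is "\<lambda>f g p. f p * g p"
  by (erule (1) eventually_elim2) simp

instance
proof
  have "\<not> eventually (\<lambda>p :: complex \<times> complex. (0::complex) = 1) (nhds 0)"
    by simp
  then show "(0::fgerm) \<noteq> 1"
    by transfer
qed (transfer; simp add: algebra_simps)+

end

lift_definition value0 :: "fgerm \<Rightarrow> complex" is "\<lambda>f. f 0"
  by (rule eventually_nhds_x_imp_x)

lift_definition const_germ :: "complex \<Rightarrow> fgerm" is "\<lambda>c p. c" .

lift_definition partial_x :: "fgerm \<Rightarrow> fgerm" is "\<lambda>f (x, y). deriv (\<lambda>t. f (t, y)) x"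
proof -
  fix f g :: "complex \<times> complex \<Rightarrow> complex"
  assume "eventually (\<lambda>p. f p = g p) (nhds 0)"
  then have "eventually (\<lambda>p. eventually (\<lambda>q. f q = g q) (nhds p)) (nhds 0)"
    by (simp add: eventually_eventually)
  then show "eventually (\<lambda>p. (case p of (x, y) \<Rightarrow> deriv (\<lambda>t. f (t, y)) x) =
      (case p of (x, y) \<Rightarrow> deriv (\<lambda>t. g (t, y)) x)) (nhds 0)"
  proof (rule eventually_mono)
    fix p :: "complex \<times> complex"
    assume *: "eventually (\<lambda>q. f q = g q) (nhds p)"
    have "filterlim (\<lambda>t. (t, snd p)) (nhds p) (nhds (fst p))"
      by (cases p) (auto intro!: tendsto_Pair filterlim_ident tendsto_const)
    from eventually_compose_filterlim[OF * this]
    show "(case p of (x, y) \<Rightarrow> deriv (\<lambda>t. f (t, y)) x) =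
        (case p of (x, y) \<Rightarrow> deriv (\<lambda>t. g (t, y)) x)"
      by (cases p) (auto intro: deriv_cong_ev)
  qed
qed

lift_definition partial_y :: "fgerm \<Rightarrow> fgerm" is "\<lambda>f (x, y). deriv (\<lambda>t. f (x, t)) y"
proof -
  fix f g :: "complex \<times> complex \<Rightarrow> complex"
  assume "eventually (\<lambda>p. f p = g p) (nhds 0)"
  then have "eventually (\<lambda>p. eventually (\<lambda>q. f q = g q) (nhds p)) (nhds 0)"
    by (simp add: eventually_eventually)
  then show "eventually (\<lambda>p. (case p of (x, y) \<Rightarrow> deriv (\<lambda>t. f (x, t)) y) =
      (case p of (x, y) \<Rightarrow> deriv (\<lambda>t. g (x, t)) y)) (nhds 0)"
  proof (rule eventually_mono)
    fix p :: "complex \<times> complex"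
    assume *: "eventually (\<lambda>q. f q = g q) (nhds p)"
    have "filterlim (\<lambda>t. (fst p, t)) (nhds p) (nhds (snd p))"
      by (cases p) (auto intro!: tendsto_Pair filterlim_ident tendsto_const)
    from eventually_compose_filterlim[OF * this]
    show "(case p of (x, y) \<Rightarrow> deriv (\<lambda>t. f (x, t)) y) =
        (case p of (x, y) \<Rightarrow> deriv (\<lambda>t. g (x, t)) y)"
      by (cases p) (auto intro: deriv_cong_ev)
  qed
qed


section \<open>The local ring \<open>\<O>\<^sub>2\<close>\<close>

text \<open>Complex differentiability: the real Frechet derivative is a \<open>\<complex>\<close>-linear form.\<close>

definition complex_differentiable2 :: "(complex \<times> complex \<Rightarrow> complex) \<Rightarrow> complex \<times> complex \<Rightarrow> bool" where
  "complex_differentiable2 f p \<longleftrightarrow>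
     (\<exists>a b. (f has_derivative (\<lambda>(u, v). a * u + b * v)) (at p))"

definition holomorphic_near0 :: "(complex \<times> complex \<Rightarrow> complex) \<Rightarrow> bool" where
  "holomorphic_near0 f \<longleftrightarrow> eventually (complex_differentiable2 f) (nhds 0)"

definition O2 :: "fgerm ring" where
  "O2 = \<lparr>carrier = germ ` {f. holomorphic_near0 f}, mult = (*), one = 1, zero = 0, add = (+)\<rparr>"

definition max_ideal :: "fgerm set" where
  "max_ideal = {F \<in> carrier O2. value0 F = 0}"

lemma complex_differentiable2_const: "complex_differentiable2 (\<lambda>p. c) p"
  unfolding complex_differentiable2_def
  by (intro exI[of _ 0]) (simp add: case_prod_unfold)

lemma complex_differentiable2_add:
  assumes "complex_differentiable2 f p" "complex_differentiable2 g p"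
  shows "complex_differentiable2 (\<lambda>p. f p + g p) p"
proof -
  obtain a b c d where
    "(f has_derivative (\<lambda>(u, v). a * u + b * v)) (at p)"
    "(g has_derivative (\<lambda>(u, v). c * u + d * v)) (at p)"
    using assms unfolding complex_differentiable2_def by blast
  from has_derivative_add[OF this]
  have "((\<lambda>p. f p + g p) has_derivative (\<lambda>(u, v). (a + c) * u + (b + d) * v)) (at p)"
    by (simp add: case_prod_unfold algebra_simps)
  then show ?thesis
    unfolding complex_differentiable2_def by blast
qed

lemma complex_differentiable2_mult:
  assumes "complex_differentiable2 f p" "complex_differentiable2 g p"
  shows "complex_differentiable2 (\<lambda>p. f p * g p) p"
proof -
  obtain a b c d where
    "(f has_derivative (\<lambda>(u, v). a * u + b * v)) (at p)"
    "(g has_derivative (\<lambda>(u, v). c * u + d * v)) (at p)"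
    using assms unfolding complex_differentiable2_def by blast
  from has_derivative_mult[OF this]
  have "((\<lambda>p. f p * g p) has_derivative
      (\<lambda>(u, v). (f p * c + a * g p) * u + (f p * d + b * g p) * v)) (at p)"
    by (simp add: case_prod_unfold algebra_simps)
  then show ?thesis
    unfolding complex_differentiable2_def by blast
qed

lemma complex_differentiable2_inverse:
  assumes "complex_differentiable2 f p" "f p \<noteq> 0"
  shows "complex_differentiable2 (\<lambda>p. inverse (f p)) p"
proof -
  obtain a b where
    "(f has_derivative (\<lambda>(u, v). a * u + b * v)) (at p)"
    using assms unfolding complex_differentiable2_def by blast
  from Deriv.has_derivative_inverse[OF assms(2) this]
  have "((\<lambda>p. inverse (f p)) has_derivative
      (\<lambda>(u, v). (- (inverse (f p) * a * inverse (f p))) * u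
        + (- (inverse (f p) * b * inverse (f p))) * v)) (at p)"
    by (simp add: case_prod_unfold algebra_simps)
  then show ?thesis
    unfolding complex_differentiable2_def by blast
qed

lemma O2_simps [simp]:
  "mult O2 = (*)" "one O2 = 1" "zero O2 = 0" "add O2 = (+)"
  by (simp_all add: O2_def)

lemma germ_in_O2: "holomorphic_near0 f \<Longrightarrow> germ f \<in> carrier O2"
  by (simp add: O2_def)

lemma O2_cases:
  assumes "F \<in> carrier O2"
  obtains f where "holomorphic_near0 f" "F = germ f"
  using assms by (auto simp: O2_def)

lemma const_in_O2: "const_germ c \<in> carrier O2"
  unfolding const_germ.abs_eq
  by (intro germ_in_O2) (simp add: holomorphic_near0_def always_eventually complex_differentiable2_const)

lemma zero_in_O2: "0 \<in> carrier O2" and one_in_O2: "1 \<in> carrier O2"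
  using const_in_O2[of 0] const_in_O2[of 1]
  unfolding const_germ.abs_eq zero_fgerm_def one_fgerm_def by simp_all

lemma add_in_O2: "F \<in> carrier O2 \<Longrightarrow> G \<in> carrier O2 \<Longrightarrow> F + G \<in> carrier O2"
  by (elim O2_cases)
    (auto simp: plus_fgerm.abs_eq holomorphic_near0_def
      intro!: germ_in_O2 complex_differentiable2_add elim: eventually_elim2)

lemma mult_in_O2: "F \<in> carrier O2 \<Longrightarrow> G \<in> carrier O2 \<Longrightarrow> F * G \<in> carrier O2"
  by (elim O2_cases)
    (auto simp: times_fgerm.abs_eq holomorphic_near0_def
      intro!: germ_in_O2 complex_differentiable2_mult elim: eventually_elim2)

lemma uminus_in_O2:
  assumes "F \<in> carrier O2"
  shows "- F \<in> carrier O2"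
proof -
  have "const_germ (-1) * F = - F"
    by transfer simp
  then show ?thesis
    using mult_in_O2[OF const_in_O2 assms] by metis
qed

lemma cring_O2: "cring O2"
proof (rule cringI)
  show "abelian_group O2"
    by (rule abelian_groupI)
      (auto simp: zero_in_O2 add_in_O2 algebra_simps intro: bexI[of _ "- _"] uminus_in_O2)
  show "comm_monoid O2"
    by (rule comm_monoidI) (auto simp: one_in_O2 mult_in_O2 algebra_simps)
qed (auto simp: algebra_simps)

lemma value0_simps [simp]:
  "value0 0 = 0" "value0 1 = 1" "value0 (const_germ c) = c"
  "value0 (F + G) = value0 F + value0 G" "value0 (F * G) = value0 F * value0 G"
  by (transfer; simp)+

lemma O2_inverse:
  assumes "F \<in> carrier O2" "value0 F \<noteq> 0"
  shows "\<exists>G \<in> carrier O2. G * F = 1"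
proof -
  obtain f where f: "holomorphic_near0 f" "F = germ f"
    using assms(1) by (rule O2_cases)
  have f0: "f 0 \<noteq> 0"
    using assms(2) unfolding f(2) value0.abs_eq .
  have "complex_differentiable2 f 0"
    using f(1) unfolding holomorphic_near0_def by (rule eventually_nhds_x_imp_x)
  then have "isCont f 0"
    unfolding complex_differentiable2_def using has_derivative_continuous by blast
  then have "filterlim f (nhds (f 0)) (nhds 0)"
    unfolding isCont_def by (simp add: tendsto_nhds_iff)
  then have ne: "eventually (\<lambda>p. f p \<noteq> 0) (nhds 0)"
    using f0 tendsto_imp_eventually_ne by blast
  have "holomorphic_near0 (\<lambda>p. inverse (f p))"
    unfolding holomorphic_near0_def
    using ne f(1)[unfolded holomorphic_near0_def]
    by eventually_elim (rule complex_differentiable2_inverse)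
  moreover have "germ (\<lambda>p. inverse (f p)) * F = 1"
    unfolding f(2) times_fgerm.abs_eq one_fgerm_def fgerm.abs_eq_iff
    using ne by eventually_elim simp
  ultimately show ?thesis
    using germ_in_O2 by blast
qed

lemma ideal_max_ideal: "ideal max_ideal O2"
proof (rule idealI)
  interpret cring O2 by (rule cring_O2)
  show "ring O2" by (rule ring_axioms)
  show "subgroup max_ideal (add_monoid O2)"
  proof (rule add.subgroupI)
    show "max_ideal \<subseteq> carrier O2" by (auto simp: max_ideal_def)
    show "max_ideal \<noteq> {}" using zero_in_O2 by (auto simp: max_ideal_def)
  next
    fix F assume F: "F \<in> max_ideal"
    have "\<ominus>\<^bsub>O2\<^esub> F \<in> carrier O2" "F + \<ominus>\<^bsub>O2\<^esub> F = 0"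
      using F r_neg[of F] by (auto simp: max_ideal_def)
    then have "value0 (\<ominus>\<^bsub>O2\<^esub> F) = 0"
      using F value0_simps(4)[of F "\<ominus>\<^bsub>O2\<^esub> F"] by (simp add: max_ideal_def)
    then show "\<ominus>\<^bsub>O2\<^esub> F \<in> max_ideal"
      using \<open>\<ominus>\<^bsub>O2\<^esub> F \<in> carrier O2\<close> by (simp add: max_ideal_def)
  qed (auto simp: max_ideal_def add_in_O2)
qed (auto simp: max_ideal_def mult_in_O2)

lemma proper_ideal_subset_max_ideal:
  assumes "ideal J O2" "J \<noteq> carrier O2"
  shows "J \<subseteq> max_ideal"
proof
  fix F assume F: "F \<in> J"
  interpret J: ideal J O2 by fact
  have "F \<in> carrier O2" using F J.Icarr by blast
  moreover have "value0 F = 0"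
  proof (rule ccontr)
    assume "value0 F \<noteq> 0"
    then obtain G where "G \<in> carrier O2" "G * F = 1"
      using O2_inverse \<open>F \<in> carrier O2\<close> by blast
    then have "1 \<in> J" using J.I_l_closed[OF F] by fastforce
    then show False using J.one_imp_carrier assms(2) by simp
  qed
  ultimately show "F \<in> max_ideal" by (simp add: max_ideal_def)
qed

lemma one_notin_max_ideal: "1 \<notin> max_ideal"
  by (simp add: max_ideal_def)

text \<open>\<open>\<O>\<^sub>2\<close> is local, with maximal ideal \<^const>\<open>max_ideal\<close>.\<close>

lemma maximalideal_O2_iff: "maximalideal J O2 \<longleftrightarrow> J = max_ideal"
proof
  have sub: "max_ideal \<subseteq> carrier O2" by (auto simp: max_ideal_def)
  have ne: "max_ideal \<noteq> carrier O2" using one_notin_max_ideal one_in_O2 by blast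
  show "maximalideal J O2 \<Longrightarrow> J = max_ideal"
    using maximalideal.I_maximal[OF _ ideal_max_ideal _ sub] maximalideal.I_notcarr[of J O2]
      maximalideal.axioms(1)[of J O2] proper_ideal_subset_max_ideal[of J] ne by metis
  have "maximalideal max_ideal O2"
    using ideal_max_ideal ne proper_ideal_subset_max_ideal
    by (intro maximalidealI) (simp_all, blast+)
  then show "J = max_ideal \<Longrightarrow> maximalideal J O2" by simp
qed


section \<open>Jacobian ideals and higher Tjurina numbers\<close>

definition jacobian_ideal :: "fgerm \<Rightarrow> fgerm set" where
  "jacobian_ideal F = Idl\<^bsub>O2\<^esub> {partial_x F, partial_y F}"

text \<open>The power of the maximal ideal is taken in the semiring of ideals; in particular
  \<open>\<mm>\<^sup>0 = \<O>\<^sub>2\<close>.\<close>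

definition tjurina_ideal :: "nat \<Rightarrow> fgerm \<Rightarrow> fgerm set" where
  "tjurina_ideal k F =
     ((max_ideal [^]\<^bsub>ideals_set O2\<^esub> k) \<cdot>\<^bsub>O2\<^esub> jacobian_ideal F) <+>\<^bsub>O2\<^esub> (PIdl\<^bsub>O2\<^esub> F)"

text \<open>\<open>dim\<^sub>\<complex> (\<O>\<^sub>2 / I)\<close>, where \<open>\<complex>\<close> acts on the quotient through the classes of the constants.\<close>

definition quotient_dim :: "fgerm set \<Rightarrow> enat" where
  "quotient_dim I =
     (let Q = O2 Quot I; K = range (\<lambda>c. I +>\<^bsub>O2\<^esub> const_germ c)
      in if ring.finite_dimension Q K (carrier Q) then enat (ring.dim Q K (carrier Q)) else \<infinity>)"

definition tjurina :: "nat \<Rightarrow> fgerm \<Rightarrow> enat" where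
  "tjurina k F = quotient_dim (tjurina_ideal k F)"


section \<open>Isolated singularities and topological equivalence\<close>

lift_definition isolated_common_zero :: "fgerm \<Rightarrow> fgerm \<Rightarrow> bool" is
  "\<lambda>f g. f 0 = 0 \<and> g 0 = 0 \<and> eventually (\<lambda>p. \<not> (f p = 0 \<and> g p = 0)) (at 0)"
proof -
  fix f f' g g' :: "complex \<times> complex \<Rightarrow> complex"
  assume f: "eventually (\<lambda>p. f p = f' p) (nhds 0)" and g: "eventually (\<lambda>p. g p = g' p) (nhds 0)"
  have 0: "f 0 = f' 0" "g 0 = g' 0"
    using eventually_nhds_x_imp_x[OF f] eventually_nhds_x_imp_x[OF g] by auto
  have "eventually (\<lambda>p. f p = f' p \<and> g p = g' p) (at 0)"
    using f g by (auto simp: eventually_at_filter elim: eventually_elim2)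
  then have "eventually (\<lambda>p. \<not> (f p = 0 \<and> g p = 0)) (at 0) \<longleftrightarrow>
      eventually (\<lambda>p. \<not> (f' p = 0 \<and> g' p = 0)) (at 0)"
    by (intro eventually_subst) (erule eventually_mono, simp)
  with 0 show "(f 0 = 0 \<and> g 0 = 0 \<and> eventually (\<lambda>p. \<not> (f p = 0 \<and> g p = 0)) (at 0)) \<longleftrightarrow>
      (f' 0 = 0 \<and> g' 0 = 0 \<and> eventually (\<lambda>p. \<not> (f' p = 0 \<and> g' p = 0)) (at 0))"
    by simp
qed

definition isolated_singularity :: "fgerm \<Rightarrow> bool" where
  "isolated_singularity F \<longleftrightarrow>
     F \<in> max_ideal \<and> isolated_common_zero (partial_x F) (partial_y F)"

text \<open>A germ of homeomorphism of \<open>(\<complex>\<^sup>2, 0)\<close> carrying \<open>{f = 0}\<close> to \<open>{g = 0}\<close>. Because \<open>U\<close> and \<open>V\<close> may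
  be shrunk, requiring equality of the zero sets in all of \<open>U\<close> and \<open>V\<close> is equality of set germs.\<close>

definition zero_sets_homeomorphic ::
  "(complex \<times> complex \<Rightarrow> complex) \<Rightarrow> (complex \<times> complex \<Rightarrow> complex) \<Rightarrow> bool" where
  "zero_sets_homeomorphic f g \<longleftrightarrow>
     (\<exists>U V \<phi> \<psi>. open U \<and> 0 \<in> U \<and> open V \<and> 0 \<in> V \<and> homeomorphism U V \<phi> \<psi> \<and> \<phi> 0 = 0 \<and>
        \<phi> ` {p \<in> U. f p = 0} = {q \<in> V. g q = 0})"

lemma zero_sets_homeomorphic_cong:
  assumes f: "eventually (\<lambda>p. f p = f' p) (nhds 0)" and g: "eventually (\<lambda>p. g p = g' p) (nhds 0)"
    and "zero_sets_homeomorphic f g"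
  shows "zero_sets_homeomorphic f' g'"
proof -
  obtain U V \<phi> \<psi> where U: "open U" "0 \<in> U" and V: "open V" "0 \<in> V"
    and hom: "homeomorphism U V \<phi> \<psi>" and \<phi>0: "\<phi> 0 = 0"
    and eq: "\<phi> ` {p \<in> U. f p = 0} = {q \<in> V. g q = 0}"
    using assms(3) unfolding zero_sets_homeomorphic_def by blast
  obtain A where A: "open A" "0 \<in> A" "\<And>p. p \<in> A \<Longrightarrow> f p = f' p"
    using f unfolding eventually_nhds by blast
  obtain B where B: "open B" "0 \<in> B" "\<And>p. p \<in> B \<Longrightarrow> g p = g' p"
    using g unfolding eventually_nhds by blast
  have inv: "\<psi> (\<phi> p) = p" "\<phi> p \<in> V" if "p \<in> U" for p
    using hom that unfolding homeomorphism_def by auto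
  have inv': "\<phi> (\<psi> q) = q" "\<psi> q \<in> U" if "q \<in> V" for q
    using hom that unfolding homeomorphism_def by auto
  define U' where "U' = (U \<inter> \<phi> -` B) \<inter> A"
  define V' where "V' = (V \<inter> \<psi> -` A) \<inter> B"
  have img: "\<phi> ` U' = V'"
  proof
    show "\<phi> ` U' \<subseteq> V'"
    proof
      fix q assume "q \<in> \<phi> ` U'"
      then obtain p where "p \<in> U'" "q = \<phi> p" by blast
      then show "q \<in> V'" unfolding U'_def V'_def using inv by simp
    qed
    show "V' \<subseteq> \<phi> ` U'"
    proof
      fix q assume q: "q \<in> V'"
      then have "\<psi> q \<in> U'" "q = \<phi> (\<psi> q)" unfolding U'_def V'_def using inv' by auto
      then show "q \<in> \<phi> ` U'" by blast
    qed
  qed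
  have "open U'"
    unfolding U'_def using hom U A B
    by (intro open_Int continuous_open_preimage) (auto simp: homeomorphism_def)
  moreover have "open V'"
    unfolding V'_def using hom V A B
    by (intro open_Int continuous_open_preimage) (auto simp: homeomorphism_def)
  moreover have "0 \<in> U'" unfolding U'_def using U A B \<phi>0 by simp
  moreover from this have "0 \<in> V'" using img \<phi>0 by force
  moreover have "homeomorphism U' V' \<phi> \<psi>"
  proof (rule homeomorphism_of_subsets[OF hom _ _ img])
    show "U' \<subseteq> U" "V' \<subseteq> V" unfolding U'_def V'_def by blast+
  qed
  moreover have "\<phi> ` {p \<in> U'. f' p = 0} = {q \<in> V'. g' q = 0}"
  proof -
    have *: "f p = 0 \<longleftrightarrow> g (\<phi> p) = 0" if "p \<in> U" for p
    proof
      assume "f p = 0" then show "g (\<phi> p) = 0" using eq that by blast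
    next
      assume "g (\<phi> p) = 0"
      then have "\<phi> p \<in> \<phi> ` {p \<in> U. f p = 0}" unfolding eq using inv(2)[OF that] by simp
      then obtain p' where p': "p' \<in> U" "f p' = 0" "\<phi> p = \<phi> p'" by blast
      have "p = p'"
        by (rule trans[OF inv(1)[OF that, symmetric] trans[OF arg_cong[OF p'(3), of \<psi>] inv(1)[OF p'(1)]]])
      then show "f p = 0" using p'(2) by simp
    qed
    have **: "f' p = 0 \<longleftrightarrow> g' (\<phi> p) = 0" if "p \<in> U'" for p
      using that *[of p] A(3)[of p] B(3)[of "\<phi> p"] unfolding U'_def by simp
    show ?thesis unfolding img[symmetric] using ** by blast
  qed
  ultimately show ?thesis
    using \<phi>0 unfolding zero_sets_homeomorphic_def by (intro exI conjI)
qed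

lift_definition topologically_equivalent :: "fgerm \<Rightarrow> fgerm \<Rightarrow> bool" is zero_sets_homeomorphic
proof -
  fix f f' g g' :: "complex \<times> complex \<Rightarrow> complex"
  assume "eventually (\<lambda>p. f p = f' p) (nhds 0)" "eventually (\<lambda>p. g p = g' p) (nhds 0)"
  moreover from this
  have "eventually (\<lambda>p. f' p = f p) (nhds 0)" "eventually (\<lambda>p. g' p = g p) (nhds 0)"
    by (simp_all add: eq_commute)
  ultimately show "zero_sets_homeomorphic f g = zero_sets_homeomorphic f' g'"
    using zero_sets_homeomorphic_cong by blast
qed

definition topological_invariant :: "(fgerm \<Rightarrow> 'a) \<Rightarrow> bool" where
  "topological_invariant T \<longleftrightarrow>
     (\<forall>F G. isolated_singularity F \<longrightarrow> isolated_singularity G \<longrightarrow>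
        topologically_equivalent F G \<longrightarrow> T F = T G)"

end

(* The curves y^3 = x^7 and y^3 + x^5 y = x^7 are matched fibrewise over x by the map
   Y |-> a(x) Y + b(x) cnj Y coming from Cardano's formula; since it is real linear with
   |b(x)| < |a(x)|, it is injective, and b(x) = O(|x|^(1/3)) makes it continuous at x = 0.

   Dividing by a coordinate, f(x,y) = f(0,y) + x g(x,y) with g holomorphic, yields Taylor
   coefficients of germs with simple shift rules. The ideals are then compared with
   <x^7, x^6 y, x y^2, y^3> and <x^7, x^5 y, y^3, 3 x y^2 + x^6>: the coefficients of the
   monomials outside (for the second ideal with the functional c_12 - 3 c_60) are linear forms
   that vanish on the ideal and are dual to a spanning set of the quotient. *)

theory Submission
  imports Defs "HOL-Complex_Analysis.Complex_Analysis"
begin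

section \<open>Topological equivalence\<close>


text \<open>A holomorphic coordinate change preserves the first Tjurina number, so the homeomorphism
  has to leave the holomorphic category; the conjugate in \<open>cubic_map\<close> is where it does.
  The drop from 14 to 13 comes from the Euler relation. The germ f is weighted homogeneous, hence
  lies in m j(f), whose codimension is the Milnor number 12 plus 2 for the two minimal generators of
  j(f). The term x^5 y has higher weight than f. Once it is added, g - x g_x/7 - y g_y/3 is a
  nonzero multiple of x^5 y, which lies outside m j(g), so adjoining g removes one dimension.
  Membership in an ideal asks for holomorphic cofactors. The expansions therefore have to end in
  remainders that are multiples, within the ring, of chosen monomials, and this is why coefficients
  are produced by division and not by differentiation.\<close>

text \<open>For \<open>Y\<^sup>3 = x\<^sup>7\<close>, Cardano's formula writes a root of \<open>z\<^sup>3 + x\<^sup>5 z - x\<^sup>7\<close> as \<open>A + B\<close> with \<open>A\<^sup>3 = w x\<^sup>7\<close>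
  and \<open>AB = - x\<^sup>5/3\<close>, where \<open>w (1 - w) = - x/27\<close> and \<open>w\<close> is near \<open>1\<close>. Taking \<open>A = w\<^sup>1\<^sup>/\<^sup>3 Y\<close> makes \<open>B\<close> a
  multiple of \<open>1/Y\<close>, that is of the conjugate of \<open>Y\<close>, because \<open>|Y|\<^sup>2 = |x|\<^sup>1\<^sup>4\<^sup>/\<^sup>3\<close> depends on \<open>x\<close> only.\<close>

text \<open>For \<open>Y\<^sup>3 = x\<^sup>7\<close>, Cardano's formula writes a root of \<open>z\<^sup>3 + x\<^sup>5 z - x\<^sup>7\<close> as \<open>A + B\<close> with \<open>A\<^sup>3 = w x\<^sup>7\<close>
  and \<open>AB = - x\<^sup>5/3\<close>, where \<open>w (1 - w) = - x/27\<close> and \<open>w\<close> is near \<open>1\<close>. Taking \<open>A = w\<^sup>1\<^sup>/\<^sup>3 Y\<close> makes \<open>B\<close> a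
  multiple of \<open>1/Y\<close>, that is of the conjugate of \<open>Y\<close>, because \<open>|Y|\<^sup>2 = |x|\<^sup>1\<^sup>4\<^sup>/\<^sup>3\<close> depends on \<open>x\<close> only.\<close>

definition cardano_weight :: "complex \<Rightarrow> complex" where
  "cardano_weight x = (1 + csqrt (1 + 4 * x / 27)) / 2"

definition cardano_root :: "complex \<Rightarrow> complex" where
  "cardano_root x = exp (Ln (cardano_weight x) / 3)"

definition cardano_conj :: "complex \<Rightarrow> complex" where
  "cardano_conj x = - (x ^ 5) / (3 * cardano_root x * of_real (norm x powr (14/3)))"

definition cubic_map :: "complex \<times> complex \<Rightarrow> complex \<times> complex" where
  "cubic_map = (\<lambda>(x, y). (x, cardano_root x * y + cardano_conj x * cnj y))"

text \<open>The principal square root has nonnegative real part for every \<open>x\<close>. The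
  bound keeps the weight away from 0 and off the branch cut of \<open>Ln\<close>, so that its cube
  root can be chosen continuously.\<close>

lemma cardano_weight_Re: "1/2 \<le> Re (cardano_weight x)"
  unfolding cardano_weight_def using Re_csqrt[of "1 + 4 * x / 27"] by (simp del: Re_csqrt)

lemma cardano_weight_quadratic: "cardano_weight x * (1 - cardano_weight x) = - x / 27"
proof -
  have "csqrt (1 + 4 * x / 27) ^ 2 = 1 + 4 * x / 27" by simp
  then show ?thesis unfolding cardano_weight_def by (simp add: field_simps power2_eq_square)
qed

lemma cardano_weight_nonzero: "cardano_weight x \<noteq> 0"
  using cardano_weight_Re[of x] by auto

lemma cardano_root_cubed: "cardano_root x ^ 3 = cardano_weight x"
  using cardano_weight_nonzero[of x] exp_of_nat_mult[of 3 "Ln (cardano_weight x) / 3"]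
  by (simp add: cardano_root_def)

lemma cardano_root_nonzero [simp]: "cardano_root x \<noteq> 0"
  by (simp add: cardano_root_def)

text \<open>The constant works because (3/4)^3 = 27/64 is below the lower bound 1/2 for the
  weight.\<close>

lemma norm_cardano_root: "3/4 < norm (cardano_root x)"
proof (rule ccontr)
  assume "\<not> 3/4 < norm (cardano_root x)"
  then have "norm (cardano_root x) ^ 3 \<le> (3/4) ^ 3" by (intro power_mono) auto
  moreover have "norm (cardano_root x) ^ 3 = norm (cardano_weight x)"
    unfolding cardano_root_cubed[symmetric] by (rule norm_power[symmetric])
  moreover have "1/2 \<le> norm (cardano_weight x)"
    using cardano_weight_Re[of x] complex_Re_le_cmod order_trans by blast
  ultimately show False by (simp add: power3_eq_cube)
qed

text \<open>The exponent is 5 - 14/3 = 1/3. At \<open>x = 0\<close> both sides are 0, the left one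
  through division by zero.\<close>

lemma norm_cardano_conj: "norm (cardano_conj x) = norm x powr (1/3) / (3 * norm (cardano_root x))"
proof (cases "x = 0")
  case False
  have "norm x powr (1/3) * norm x powr (14/3) = norm x ^ 5"
    unfolding powr_add[symmetric] using False powr_realpow[of "norm x" 5] by simp
  then have "norm x ^ 5 / norm x powr (14/3) = norm x powr (1/3)"
    using False by (simp add: divide_eq_eq)
  moreover have "norm (cardano_conj x) = norm x ^ 5 / norm x powr (14/3) / (3 * norm (cardano_root x))"
    by (simp add: cardano_conj_def norm_mult norm_divide norm_power)
  ultimately show ?thesis by simp
qed (simp add: cardano_conj_def)

lemma continuous_on_cardano_root: "continuous_on (ball 0 1) cardano_root"
proof -
  have 1: "1 + 4 * x / 27 \<notin> \<real>\<^sub>\<le>\<^sub>0" if "norm x < 1" for x :: complex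
  proof -
    have "\<bar>Re x\<bar> < 1" using that abs_Re_le_cmod[of x] by linarith
    then have "0 < Re (1 + 4 * x / 27)" by simp
    then show ?thesis by (auto simp: complex_nonpos_Reals_iff)
  qed
  have 2: "cardano_weight x \<notin> \<real>\<^sub>\<le>\<^sub>0" for x
    using cardano_weight_Re[of x] by (auto simp: complex_nonpos_Reals_iff)
  have "continuous_on (ball 0 1) cardano_weight"
    unfolding cardano_weight_def using 1
    by (intro continuous_intros continuous_on_compose2[OF continuous_on_csqrt]) auto
  then show ?thesis
    unfolding cardano_root_def using 2 by (intro continuous_intros) auto
qed

lemma continuous_on_cardano_conj: "continuous_on (ball 0 1) cardano_conj"
proof -
  have "isCont cardano_conj x" if x: "x \<in> ball 0 1" for x
  proof (cases "x = 0")
    case False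
    have r: "isCont cardano_root x"
      using continuous_on_cardano_root x by (simp add: continuous_on_eq_continuous_at)
    show ?thesis unfolding cardano_conj_def
      using False by (intro continuous_intros r) auto
  next
    case True
    \<comment> \<open>At 0 the denominator of \<open>cardano_conj\<close> vanishes, so the limit is
      read off from the norm, where the singular factor has cancelled.\<close>
    have "((\<lambda>x. norm x powr (1/3) / (3 * norm (cardano_root x))) \<longlongrightarrow> 0) (at 0)"
    proof -
      have r: "isCont cardano_root 0"
        using continuous_on_cardano_root by (simp add: continuous_on_eq_continuous_at)
      have "isCont (\<lambda>x::complex. norm x powr (1/3) / (3 * norm (cardano_root x))) 0"
        by (intro continuous_intros r) auto
      then show ?thesis by (simp add: isCont_def)
    qed
    then have "((\<lambda>x. norm (cardano_conj x)) \<longlongrightarrow> 0) (at 0)" by (simp add: norm_cardano_conj)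
    then have "(cardano_conj \<longlongrightarrow> 0) (at 0)" by (rule tendsto_norm_zero_cancel)
    then show ?thesis using True by (simp add: isCont_def cardano_conj_def)
  qed
  then show ?thesis by (simp add: continuous_at_imp_continuous_on)
qed

lemma inj_cubic_map: "inj_on cubic_map (ball 0 1 \<times> UNIV)"
proof -
  have "y = y'" if x: "norm x < 1"
    and eq: "cardano_root x * y + cardano_conj x * cnj y = cardano_root x * y' + cardano_conj x * cnj y'"
    for x y y'
  proof (rule ccontr)
    assume "y \<noteq> y'"
    have "cardano_root x * (y - y') = - (cardano_conj x * cnj (y - y'))"
      using eq by (simp add: algebra_simps)
    from arg_cong[OF this, of norm]
    have "norm (cardano_root x) * norm (y - y') = norm (cardano_conj x) * norm (y - y')"
      by (simp only: norm_minus_cancel norm_mult complex_mod_cnj)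
    with \<open>y \<noteq> y'\<close> have *: "norm (cardano_root x) = norm (cardano_conj x)" by simp
    \<comment> \<open>Equal norms would force 3|a|^2 = |x|^(1/3) <= 1 for
      \<open>a = cardano_root x\<close>, whereas |a| > 3/4 gives 3|a|^2 > 27/16.\<close>
    have "norm x powr (1/3) \<le> 1" using x by (intro powr_le1) auto
    moreover have "norm (cardano_root x) * (3 * norm (cardano_root x)) > (3/4) * (3 * (3/4))"
      by (rule mult_strict_mono'[OF norm_cardano_root mult_strict_left_mono[OF norm_cardano_root]]) auto
    moreover have "norm (cardano_root x) * (3 * norm (cardano_root x)) = norm x powr (1/3)"
      using *[unfolded norm_cardano_conj eq_divide_eq] by simp
    ultimately show False by linarith
  qed
  note inj = this
  show ?thesis
  proof (rule inj_onI, clarify)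
    fix x y x' y' :: complex
    assume "x \<in> ball 0 1" "cubic_map (x, y) = cubic_map (x', y')"
    then show "x = x' \<and> y = y'"
      using inj[of x y y'] unfolding cubic_map_def case_prod_conv prod.inject by force
  qed
qed

section \<open>Correspondence of the two zero sets\<close>

lemma cardano_product:
  assumes "y ^ 3 = x ^ 7"
  shows "(cardano_root x * y) * (cardano_conj x * cnj y) = - (x ^ 5) / 3"
    and "(cardano_root x * y) ^ 3 + (cardano_conj x * cnj y) ^ 3 = x ^ 7"
proof -
  define A where "A = cardano_root x * y"
  define B where "B = cardano_conj x * cnj y"
  have "A * B = - (x ^ 5) / 3 \<and> A ^ 3 + B ^ 3 = x ^ 7"
  proof (cases "x = 0")
    case True
    then show ?thesis using assms by (simp add: A_def B_def cardano_conj_def)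
  next
    case False
    then have y0: "y \<noteq> 0" using assms by auto
    have "norm y ^ 3 = norm x ^ 7" using assms by (simp flip: norm_power)
    also have "\<dots> = (norm x powr (7/3)) ^ 3"
      using False powr_realpow[of "norm x" 7] by (simp add: powr_power)
    finally have "norm y = norm x powr (7/3)"
      by (rule power_eq_imp_eq_base) auto
    then have "norm y ^ 2 = norm x powr (14/3)"
      using False by (simp add: power2_eq_square flip: powr_add)
    \<comment> \<open>Only on the curve does |y|^2 equal the normalising factor in the denominator
      of \<open>cardano_conj\<close>; here the two cancel.\<close>
    then have n: "y * cnj y = of_real (norm x powr (14/3))"
      by (metis complex_norm_square of_real_power)
    have nz: "of_real (norm x powr (14/3)) \<noteq> (0::complex)" using False by simp
    have AB: "A * B = - (x ^ 5) / 3"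
    proof -
      have "A * B = cardano_root x * cardano_conj x * (y * cnj y)"
        by (simp add: A_def B_def)
      also have "\<dots> = - (x ^ 5) / 3"
        unfolding n cardano_conj_def using nz by (simp add: field_simps)
      finally show ?thesis .
    qed
    define W where "W = cardano_weight x"
    have W: "W \<noteq> 0" "W * (1 - W) = - x / 27"
      unfolding W_def by (rule cardano_weight_nonzero cardano_weight_quadratic)+
    have A3: "A ^ 3 = W * x ^ 7"
      unfolding A_def W_def power_mult_distrib cardano_root_cubed assms ..
    \<comment> \<open>The cube of \<open>B\<close> is found by dividing (AB)^3 by
      \<open>A ^ 3\<close>; the quadratic equation of the weight turns the factor -x/27 into W(1 -
      W).\<close>
    have "A ^ 3 * B ^ 3 = (- (x ^ 5) / 3) ^ 3"
      unfolding power_mult_distrib[symmetric] AB ..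
    also have "\<dots> = - (x ^ 5 * x ^ 5 * x ^ 5) / 27" by (simp add: power3_eq_cube)
    also have "x ^ 5 * x ^ 5 * x ^ 5 = x ^ (7 + 7 + 1)" unfolding power_add[symmetric] by simp
    also have "\<dots> = x ^ 7 * x ^ 7 * x" by (simp only: power_add power_one_right)
    also have "- (x ^ 7 * x ^ 7 * x) / 27 = x ^ 7 * x ^ 7 * (- x / 27)" by simp
    also have "\<dots> = A ^ 3 * (x ^ 7 * (1 - W))" unfolding A3 W(2)[symmetric] by simp
    finally have "B ^ 3 = x ^ 7 * (1 - W)" using A3 W False by simp
    then show ?thesis using A3 AB by (simp add: algebra_simps)
  qed
  then show "(cardano_root x * y) * (cardano_conj x * cnj y) = - (x ^ 5) / 3"
    and "(cardano_root x * y) ^ 3 + (cardano_conj x * cnj y) ^ 3 = x ^ 7"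
    by (simp_all add: A_def B_def)
qed

text \<open>Cardano's identity (A + B)^3 - 3AB(A + B) = A^3 + B^3.\<close>

lemma cubic_map_zero:
  assumes "y ^ 3 = x ^ 7" "z = cardano_root x * y + cardano_conj x * cnj y"
  shows "z ^ 3 + x ^ 5 * z = x ^ 7"
proof -
  define A where "A = cardano_root x * y"
  define B where "B = cardano_conj x * cnj y"
  have *: "x ^ 5 = - 3 * (A * B)" "x ^ 7 = A ^ 3 + B ^ 3"
    using cardano_product[OF assms(1)] by (simp_all add: A_def B_def)
  have "z = A + B" using assms(2) by (simp add: A_def B_def)
  then show ?thesis unfolding * by (simp add: power3_eq_cube algebra_simps)
qed

text \<open>Replacing y by wy multiplies A by w and the conjugate part B by
  \<open>cnj w = w ^ 2\<close>. This is exactly how Cardano's three roots pair the cube roots of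
  unity.\<close>

lemma exists_primitive_cube_root: "\<exists>w::complex. w ^ 2 + w + 1 = 0 \<and> cnj w = w ^ 2 \<and> w ^ 3 = 1"
proof -
  define w where "w = Complex (- 1 / 2) (sqrt 3 / 2)"
  have "w ^ 2 + w + 1 = 0" "cnj w = w ^ 2"
    by (auto simp: w_def complex_eq_iff power2_eq_square)
  moreover from this(1) have "w ^ 3 - 1 = 0"
  proof -
    have "w ^ 3 - 1 = (w - 1) * (w ^ 2 + w + 1)" by (simp add: power3_eq_cube power2_eq_square algebra_simps)
    then show ?thesis using \<open>w ^ 2 + w + 1 = 0\<close> by simp
  qed
  ultimately show ?thesis by (intro exI[of _ w]) simp
qed

text \<open>Any one cube root y of x^7 yields all three roots z, as the images of y, wy and w^2 y.
  The cubic in z is factored accordingly.\<close>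

lemma cubic_map_zero_converse:
  assumes "z ^ 3 + x ^ 5 * z = x ^ 7"
  obtains y where "y ^ 3 = x ^ 7" "z = cardano_root x * y + cardano_conj x * cnj y"
proof -
  obtain y where y: "y ^ 3 = x ^ 7"
  proof (cases "x = 0")
    case False
    then have "exp (7 / 3 * Ln x) ^ 3 = x ^ 7"
      using exp_of_nat_mult[of 7 "Ln x"] exp_of_nat_mult[of 3 "7 / 3 * Ln x"] by simp
    then show ?thesis using that by blast
  qed (use that[of 0] in simp)
  obtain w :: complex where w: "w ^ 2 + w + 1 = 0" "cnj w = w ^ 2" "w ^ 3 = 1"
    using exists_primitive_cube_root by blast
  define A where "A = cardano_root x * y"
  define B where "B = cardano_conj x * cnj y"
  have *: "x ^ 5 = - 3 * (A * B)" "x ^ 7 = A ^ 3 + B ^ 3"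
    using cardano_product[OF y] by (simp_all add: A_def B_def)
  have "(z - (A + B)) * (z - (w * A + w ^ 2 * B)) * (z - (w ^ 2 * A + w * B)) =
      z ^ 3 - 3 * (A * B) * z - (A ^ 3 + B ^ 3)"
  proof -
    define v where "v = w ^ 2"
    define S where "S = w * A + v * B"
    define T where "T = v * A + w * B"
    have v: "w + v = -1" "w * v = 1" "w * w + v * v = -1"
    proof -
      show 1: "w + v = -1" using w(1) by (simp add: v_def eq_neg_iff_add_eq_0 algebra_simps)
      show 2: "w * v = 1" using w(3) by (simp add: v_def power3_eq_cube power2_eq_square mult.assoc)
      have "w * w + v * v = (w + v) * (w + v) - 2 * (w * v)" by (simp add: algebra_simps)
      then show "w * w + v * v = -1" unfolding 1 2 by simp
    qed
    have "S + T = (w + v) * (A + B)" "S * T = (w * v) * (A * A + B * B) + (w * w + v * v) * (A * B)"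
      by (simp_all add: S_def T_def algebra_simps)
    then have ST: "S + T = - (A + B)" "S * T = A * A + B * B - A * B" unfolding v by simp_all
    have "(z - (A + B)) * (z - S) * (z - T) = (z - (A + B)) * (z * z - (S + T) * z + S * T)"
      by (simp add: algebra_simps)
    also have "\<dots> = z ^ 3 - 3 * (A * B) * z - (A ^ 3 + B ^ 3)"
      unfolding ST by (simp add: power3_eq_cube algebra_simps)
    finally show ?thesis by (simp add: S_def T_def v_def)
  qed
  also have "\<dots> = z ^ 3 + x ^ 5 * z - x ^ 7" unfolding * by simp
  also have "\<dots> = 0" using assms by simp
  finally consider "z = A + B" | "z = w * A + w ^ 2 * B" | "z = w ^ 2 * A + w * B" by auto
  then show ?thesis
  proof cases
    case 1
    then show ?thesis using that[OF y] by (simp add: A_def B_def)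
  next
    case 2
    show ?thesis using 2 y w(2,3) by (intro that[of "w * y"]) (auto simp: A_def B_def power_mult_distrib)
  next
    case 3
    have "cnj (w ^ 2) = w" using w by (metis complex_cnj_cnj)
    moreover have "(w ^ 2) ^ 3 = 1" using w(3) by (metis power_commutes power_mult mult.commute power_one)
    ultimately show ?thesis using 3 y by (intro that[of "w ^ 2 * y"]) (auto simp: A_def B_def power_mult_distrib)
  qed
qed

lemma zero_sets_homeomorphic_E12:
  "zero_sets_homeomorphic (\<lambda>(x, y). y ^ 3 - x ^ 7) (\<lambda>(x, y). y ^ 3 - x ^ 7 + x ^ 5 * y)"
proof -
  let ?U = "ball 0 1 \<times> UNIV :: (complex \<times> complex) set"
  have U: "open ?U" by (intro open_Times) auto
  have "continuous_on ?U (\<lambda>p. cardano_root (fst p))" "continuous_on ?U (\<lambda>p. cardano_conj (fst p))"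
    by (rule continuous_on_compose2[OF continuous_on_cardano_root] continuous_on_compose2[OF continuous_on_cardano_conj];
      auto intro: continuous_intros)+
  then have cont: "continuous_on ?U cubic_map"
    unfolding cubic_map_def case_prod_unfold by (intro continuous_intros)
  \<comment> \<open>Invariance of domain turns a continuous injection between spaces of equal
    dimension into a homeomorphism onto an open image.\<close>
  obtain \<psi> where \<psi>: "homeomorphism ?U (cubic_map ` ?U) cubic_map \<psi>"
    using invariance_of_domain_homeomorphism[OF U cont _ inj_cubic_map] by auto
  have "open (cubic_map ` ?U)"
    using invariance_of_domain_gen[OF U cont inj_cubic_map] by auto
  moreover have "cubic_map ` {p \<in> ?U. (case p of (x, y) \<Rightarrow> y ^ 3 - x ^ 7) = 0} =
      {q \<in> cubic_map ` ?U. (case q of (x, y) \<Rightarrow> y ^ 3 - x ^ 7 + x ^ 5 * y) = 0}" (is "?L = ?R")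
  proof
    show "?L \<subseteq> ?R"
    proof
      fix q assume "q \<in> ?L"
      then obtain x y where "x \<in> ball 0 1" "y ^ 3 = x ^ 7" "q = cubic_map (x, y)" by auto
      then show "q \<in> ?R" using cubic_map_zero[of y x "snd q"]
        by (auto simp: cubic_map_def algebra_simps)
    qed
    show "?R \<subseteq> ?L"
    proof
      fix q assume "q \<in> ?R"
      then obtain x z where x: "x \<in> ball 0 1" and q: "q = (x, z)" and z: "z ^ 3 + x ^ 5 * z = x ^ 7"
        by (auto simp: cubic_map_def algebra_simps)
      obtain y where "y ^ 3 = x ^ 7" "z = cardano_root x * y + cardano_conj x * cnj y"
        using cubic_map_zero_converse[OF z] by blast
      then show "q \<in> ?L" using x q by (intro image_eqI[of _ _ "(x, y)"]) (auto simp: cubic_map_def)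
    qed
  qed
  moreover have 0: "cubic_map 0 = 0" "0 \<in> ?U" by (simp_all add: cubic_map_def zero_prod_def)
  moreover have "0 \<in> cubic_map ` ?U" using imageI[OF 0(2), of cubic_map] unfolding 0(1) .
  ultimately show ?thesis
    unfolding zero_sets_homeomorphic_def using U \<psi>
    by (intro exI[of _ ?U] exI[of _ "cubic_map ` ?U"] exI[of _ cubic_map] exI[of _ \<psi>] conjI) assumption+
qed

section \<open>Division of a holomorphic function by a coordinate\<close>

lemma complex_differentiable2_partials:
  assumes "complex_differentiable2 f (x, y)"
  obtains a b where "(f has_derivative (\<lambda>(u, v). a * u + b * v)) (at (x, y))"
    "((\<lambda>t. f (t, y)) has_field_derivative a) (at x)"
    "((\<lambda>t. f (x, t)) has_field_derivative b) (at y)"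
proof -
  obtain a b where d: "(f has_derivative (\<lambda>(u, v). a * u + b * v)) (at (x, y))"
    using assms unfolding complex_differentiable2_def by blast
  have "((\<lambda>t. f (t, y)) has_derivative (\<lambda>u. case (u, 0) of (u, v) \<Rightarrow> a * u + b * v)) (at x)"
    using d by (intro has_derivative_compose[of "\<lambda>t. (t, y)" "\<lambda>u. (u, 0)" x UNIV f])
      (auto intro!: derivative_eq_intros)
  moreover have "((\<lambda>t. f (x, t)) has_derivative (\<lambda>v. case (0, v) of (u, v) \<Rightarrow> a * u + b * v)) (at y)"
    using d by (intro has_derivative_compose[of "\<lambda>t. (x, t)" "\<lambda>v. (0, v)" y UNIV f])
      (auto intro!: derivative_eq_intros)
  ultimately show ?thesis
    using that[OF d] by (simp add: has_field_derivative_def)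
qed

lemma complex_differentiable2_isCont: "complex_differentiable2 f p \<Longrightarrow> isCont f p"
  unfolding complex_differentiable2_def using has_derivative_continuous by blast

text \<open>Around 0 the derivative of the circle is 2 pi i times the circle itself. Contour
  integrals become integrals over [0,1], to which the theorems on parameter integrals apply.\<close>

lemma contour_integral_circlepath_0:
  "contour_integral (circlepath 0 s) h =
    2 * of_real pi * \<i> * integral {0..1} (\<lambda>t. h (circlepath 0 s t) * circlepath 0 s t)"
proof -
  have "contour_integral (circlepath 0 s) h =
      integral {0..1} (\<lambda>t. 2 * of_real pi * \<i> * (h (circlepath 0 s t) * circlepath 0 s t))"
    unfolding contour_integral_integral
    by (rule integral_cong) (simp add: vector_derivative_circlepath, simp add: circlepath)
  then show ?thesis by simp
qed

lemma continuous_circlepath: "continuous_on A (circlepath z s)"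
  unfolding circlepath by (intro continuous_intros)

lemma norm_circlepath_0: "0 \<le> s \<Longrightarrow> norm (circlepath 0 s t) = s"
  by (simp add: circlepath norm_mult)

text \<open>Differentiability alone does not include continuity of the derivative. Cauchy's formula
  writes the derivative as an integral of \<open>f\<close> against a continuous kernel, and this
  provides the continuity that the Leibniz rule demands below.\<close>

lemma continuous_on_partial_y:
  fixes f :: "complex \<times> complex \<Rightarrow> complex"
  assumes diff: "\<And>p. p \<in> ball 0 R \<times> ball 0 R \<Longrightarrow> complex_differentiable2 f p"
    and s: "0 < s" "s < R"
  shows "continuous_on (ball 0 R \<times> ball 0 s) (\<lambda>(x, y). deriv (\<lambda>t. f (x, t)) y)"
proof -
  have contf: "continuous_on (ball 0 R \<times> ball 0 R) f"
    by (intro continuous_at_imp_continuous_on ballI complex_differentiable2_isCont diff)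
  let ?c = "circlepath 0 s"
  let ?K = "\<lambda>p t. f (fst p, ?c t) / (?c t - snd p)\<^sup>2 * ?c t"
  have ne: "?c t \<noteq> y" if "y \<in> ball 0 s" for y t
    using that norm_circlepath_0[of s t] s by auto
  have "continuous_on ((ball 0 R \<times> ball 0 s) \<times> cbox 0 1) (\<lambda>(p, t). ?K p t)"
    unfolding case_prod_unfold
    by (intro continuous_intros continuous_on_compose2[OF contf] continuous_on_compose2[OF continuous_circlepath[of UNIV]])
      (use ne s in \<open>auto simp: norm_circlepath_0\<close>)
  then have "continuous_on (ball 0 R \<times> ball 0 s) (\<lambda>p. integral (cbox 0 1) (?K p))"
    by (rule integral_continuous_on_param)
  moreover have "deriv (\<lambda>t. f (x, t)) y = integral (cbox 0 1) (?K (x, y))"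
    if xy: "x \<in> ball 0 R" "y \<in> ball 0 s" for x y
  proof -
    have hol: "(\<lambda>t. f (x, t)) holomorphic_on cball 0 s"
    proof (rule holomorphic_onI)
      fix w assume "w \<in> cball (0::complex) s"
      then have "complex_differentiable2 f (x, w)" using xy s by (intro diff) auto
      then show "(\<lambda>t. f (x, t)) field_differentiable at w within cball 0 s"
        by (rule complex_differentiable2_partials)
          (auto simp: field_differentiable_def intro: has_field_derivative_at_within)
    qed
    have "((\<lambda>t. f (x, t)) has_field_derivative
        (1 / (2 * of_real pi * \<i>) * contour_integral (circlepath 0 s) (\<lambda>u. f (x, u) / (u - y)^2))) (at y)"
      by (rule Cauchy_derivative_integral_circlepath(2))
        (use hol xy in \<open>auto intro: holomorphic_on_imp_continuous_on holomorphic_on_subset\<close>)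
    from DERIV_imp_deriv[OF this] show ?thesis
      unfolding contour_integral_circlepath_0 by (simp add: field_simps)
  qed
  ultimately show ?thesis
    by (subst continuous_on_cong[OF refl, of _ _ "\<lambda>p. integral (cbox 0 1) (?K p)"]) auto
qed

text \<open>Subtracting Cauchy's formulas at x and 0 uses c/(c - x) - 1 = x/(c - x) for c on the
  circle. The remaining integral makes sense at x = 0 too, so it serves as the quotient across the
  axis.\<close>

lemma Cauchy_difference_quotient:
  assumes hol: "h holomorphic_on cball 0 s" and s: "0 < s" and x: "norm x < s"
  shows "h x - h 0 = x * integral {0..1} (\<lambda>t. h (circlepath 0 s t) / (circlepath 0 s t - x))"
proof -
  let ?c = "circlepath 0 s"
  have C: "h w = integral {0..1} (\<lambda>t. h (?c t) / (?c t - w) * ?c t)"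
    "(\<lambda>t. h (?c t) / (?c t - w) * ?c t) integrable_on {0..1}" if "norm w < s" for w
  proof -
    have "((\<lambda>u. h u / (u - w)) has_contour_integral 2 * of_real pi * \<i> * h w) (circlepath 0 s)"
      by (rule Cauchy_integral_circlepath_simple[OF hol]) (use that in simp)
    from contour_integral_unique[OF this]
    show "h w = integral {0..1} (\<lambda>t. h (?c t) / (?c t - w) * ?c t)"
      unfolding contour_integral_circlepath_0 by simp
    have "continuous_on {0..1} (\<lambda>t. h (?c t) / (?c t - w) * ?c t)"
      using that s norm_circlepath_0[of s]
      by (intro continuous_intros continuous_on_compose2[OF holomorphic_on_imp_continuous_on[OF hol]]
          continuous_circlepath) auto
    then show "(\<lambda>t. h (?c t) / (?c t - w) * ?c t) integrable_on {0..1}"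
      by (rule integrable_continuous_real)
  qed
  have "h x - h 0 = integral {0..1} (\<lambda>t. h (?c t) / (?c t - x) * ?c t - h (?c t) / (?c t - 0) * ?c t)"
    using C[OF x] C[of 0] s by (subst Henstock_Kurzweil_Integration.integral_diff) auto
  also have "\<dots> = integral {0..1} (\<lambda>t. x * (h (?c t) / (?c t - x)))"
  proof (rule integral_cong)
    fix t :: real
    have "?c t \<noteq> 0" "?c t \<noteq> x" using norm_circlepath_0[of s t] s x by auto
    then show "h (?c t) / (?c t - x) * ?c t - h (?c t) / (?c t - 0) * ?c t = x * (h (?c t) / (?c t - x))"
      by (simp add: divide_simps) (simp add: algebra_simps)
  qed
  finally show ?thesis by (simp only: integral_mult_right)
qed

lemma complex_differentiable2_Cauchy_quotient:
  fixes f :: "complex \<times> complex \<Rightarrow> complex"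
  assumes diff: "\<And>p. p \<in> ball 0 R \<times> ball 0 R \<Longrightarrow> complex_differentiable2 f p"
    and s: "0 < s" "s < R" and p0: "p0 \<in> ball 0 s \<times> ball 0 s"
  shows "complex_differentiable2
    (\<lambda>(x, y). integral {0..1} (\<lambda>t. f (circlepath 0 s t, y) / (circlepath 0 s t - x))) p0"
proof -
  let ?c = "circlepath 0 s"
  let ?U = "ball 0 s \<times> ball 0 s :: (complex \<times> complex) set"
  define fy where "fy = (\<lambda>(x, y). deriv (\<lambda>t. f (x, t)) y)"
  let ?A = "\<lambda>p t. f (?c t, snd p) / (?c t - fst p)\<^sup>2"
  let ?B = "\<lambda>p t. fy (?c t, snd p) / (?c t - fst p)"
  \<comment> \<open>The derivative of the integrand as a bounded linear map: \<open>?A\<close> and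
    \<open>?B\<close> are its partial derivatives in x and y.\<close>
  let ?L = "\<lambda>p t. (blinfun_mult_right (?A p t) o\<^sub>L fst_blinfun) + (blinfun_mult_right (?B p t) o\<^sub>L snd_blinfun)"
  let ?f = "\<lambda>p t. f (?c t, snd p) / (?c t - fst p)"
  have contf: "continuous_on (ball 0 R \<times> ball 0 R) f"
    by (intro continuous_at_imp_continuous_on ballI complex_differentiable2_isCont diff)
  have contfy: "continuous_on (ball 0 R \<times> ball 0 s) fy"
    unfolding fy_def by (rule continuous_on_partial_y[OF diff s])
  have ne: "?c t \<noteq> x" if "x \<in> ball 0 s" for x t
    using that norm_circlepath_0[of s t] s by auto
  have contA: "continuous_on (?U \<times> cbox 0 1) (\<lambda>q. ?A (fst q) (snd q))"
    by (intro continuous_intros continuous_on_compose2[OF contf] continuous_on_compose2[OF continuous_circlepath[of UNIV]])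
      (use ne s in \<open>auto simp: norm_circlepath_0\<close>)
  have contB: "continuous_on (?U \<times> cbox 0 1) (\<lambda>q. ?B (fst q) (snd q))"
    by (intro continuous_intros continuous_on_compose2[OF contfy] continuous_on_compose2[OF continuous_circlepath[of UNIV]])
      (use ne s in \<open>auto simp: norm_circlepath_0\<close>)
  have contL: "continuous_on (?U \<times> cbox 0 1) (\<lambda>(p, t). ?L p t)"
    unfolding case_prod_unfold
    by (intro continuous_intros contA contB bounded_linear.continuous_on[OF bounded_linear_blinfun_mult_right])
  have "((\<lambda>p. integral (cbox 0 1) (?f p)) has_derivative integral (cbox 0 1) (?L p0)) (at p0 within ?U)"
  proof (rule leibniz_rule[OF _ _ contL p0])
    show "convex ?U" by (intro convex_Times convex_ball)
    show "?f p integrable_on cbox 0 1" if "p \<in> ?U" for p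
      by (intro integrable_continuous continuous_intros continuous_on_compose2[OF contf]
          continuous_on_compose2[OF continuous_circlepath[of UNIV]])
        (use that ne s in \<open>auto simp: norm_circlepath_0\<close>)
    show "((\<lambda>p. ?f p t) has_derivative blinfun_apply (?L p t)) (at p within ?U)"
      if p: "p \<in> ?U" for p t
    proof -
      have "complex_differentiable2 f (?c t, snd p)"
        using p s by (intro diff) (auto simp: norm_circlepath_0)
      then obtain a b where "((\<lambda>w. f (?c t, w)) has_field_derivative b) (at (snd p))"
        by (rule complex_differentiable2_partials)
      then have "((\<lambda>w. f (?c t, w)) has_field_derivative fy (?c t, snd p)) (at (snd p))"
        by (simp add: fy_def DERIV_imp_deriv)
      then have d: "((\<lambda>w. f (?c t, w)) has_derivative (\<lambda>v. fy (?c t, snd p) * v)) (at (snd p))"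
        by (simp add: has_field_derivative_def)
      have d1: "((\<lambda>p. f (?c t, snd p)) has_derivative (\<lambda>q. fy (?c t, snd p) * snd q)) (at p)"
        using d by (intro has_derivative_compose[of snd snd p UNIV "\<lambda>w. f (?c t, w)"])
          (auto intro!: derivative_eq_intros)
      have n: "?c t - fst p \<noteq> 0" using ne[of "fst p" t] p by auto
      have "((\<lambda>p. f (?c t, snd p) / (?c t - fst p)) has_derivative
          (\<lambda>q. ?A p t * fst q + ?B p t * snd q)) (at p)"
      proof (rule has_derivative_eq_rhs)
        have "((\<lambda>p. ?c t - fst p) has_derivative (\<lambda>q. - fst q)) (at p)"
          by (auto intro!: derivative_eq_intros)
        from has_derivative_divide'[OF d1 this n]
        show "((\<lambda>p. f (?c t, snd p) / (?c t - fst p)) has_derivative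
          (\<lambda>q. (fy (?c t, snd p) * snd q * (?c t - fst p) - f (?c t, snd p) * - fst q) /
            ((?c t - fst p) * (?c t - fst p)))) (at p)" .
        have "(b * v * d - a * - u) / (d * d) = a / d\<^sup>2 * u + b / d * v" if "d \<noteq> 0" for a b u v d :: complex
          using that by (simp add: field_simps power2_eq_square)
        from this[OF n]
        show "(\<lambda>q. (fy (?c t, snd p) * snd q * (?c t - fst p) - f (?c t, snd p) * - fst q) /
            ((?c t - fst p) * (?c t - fst p))) = (\<lambda>q. ?A p t * fst q + ?B p t * snd q)"
          by (rule ext)
      qed
      moreover have "blinfun_apply (?L p t) = (\<lambda>q. ?A p t * fst q + ?B p t * snd q)"
        by (rule ext) (simp add: blinfun.add_left)
      ultimately show "((\<lambda>p. ?f p t) has_derivative blinfun_apply (?L p t)) (at p within ?U)"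
        by (simp only: has_derivative_at_withinI)
    qed
  qed
  moreover have "at p0 within ?U = at p0"
    by (rule at_within_open[OF p0]) (intro open_Times open_ball)
  ultimately have der: "((\<lambda>p. integral (cbox 0 1) (?f p)) has_derivative integral (cbox 0 1) (?L p0)) (at p0)"
    by (simp only:)
  have emb: "continuous_on (cbox 0 1) (\<lambda>t. (p0, t))" "(\<lambda>t. (p0, t)) ` cbox 0 1 \<subseteq> ?U \<times> cbox 0 1"
    using p0 by (intro continuous_intros, blast)
  have "continuous_on (cbox 0 1) (\<lambda>t. ?A p0 t)" "continuous_on (cbox 0 1) (\<lambda>t. ?B p0 t)"
    "continuous_on (cbox 0 1) (\<lambda>t. ?L p0 t)"
    using continuous_on_compose2[OF contA emb] continuous_on_compose2[OF contB emb]
      continuous_on_compose2[OF contL emb] unfolding fst_conv snd_conv case_prod_conv by this+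
  then have int: "?A p0 integrable_on cbox 0 1" "?B p0 integrable_on cbox 0 1" "?L p0 integrable_on cbox 0 1"
    by (blast intro: integrable_continuous)+
  \<comment> \<open>Evaluation at \<open>q\<close> commutes with the integral of operators, which
    exhibits the derivative as a complex linear form.\<close>
  have "blinfun_apply (integral (cbox 0 1) (?L p0)) q =
      integral (cbox 0 1) (?A p0) * fst q + integral (cbox 0 1) (?B p0) * snd q" for q
  proof -
    have "((\<lambda>t. blinfun_apply (?L p0 t) q) has_integral blinfun_apply (integral (cbox 0 1) (?L p0)) q) (cbox 0 1)"
      using has_integral_linear[OF integrable_integral[OF int(3)] blinfun.bounded_linear_left]
      by (simp only: o_def)
    moreover have "(\<lambda>t. blinfun_apply (?L p0 t) q) = (\<lambda>t. ?A p0 t * fst q + ?B p0 t * snd q)"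
      by (rule ext) (simp add: blinfun.add_left)
    moreover have "((\<lambda>t. ?A p0 t * fst q + ?B p0 t * snd q) has_integral
       (integral (cbox 0 1) (?A p0) * fst q + integral (cbox 0 1) (?B p0) * snd q)) (cbox 0 1)"
      by (intro has_integral_add has_integral_mult_left integrable_integral int)
    ultimately show ?thesis by (simp only: has_integral_unique)
  qed
  then have "blinfun_apply (integral (cbox 0 1) (?L p0)) =
      (\<lambda>(u, v). integral (cbox 0 1) (?A p0) * u + integral (cbox 0 1) (?B p0) * v)"
    unfolding case_prod_unfold by (rule ext)
  from der[unfolded this] have "complex_differentiable2 (\<lambda>p. integral (cbox 0 1) (?f p)) p0"
    unfolding complex_differentiable2_def by (intro exI)
  then show ?thesis by (simp only: case_prod_unfold cbox_interval)
qed

section \<open>Division by x near the origin\<close>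

lemma holomorphic_near0_polydisc:
  assumes "holomorphic_near0 f"
  obtains R where "0 < R" "\<forall>p \<in> ball 0 R \<times> ball 0 R. complex_differentiable2 f p"
proof -
  obtain S where S: "open S" "0 \<in> S" "\<And>p. p \<in> S \<Longrightarrow> complex_differentiable2 f p"
    using assms unfolding holomorphic_near0_def eventually_nhds by blast
  obtain e where e: "0 < e" "ball 0 e \<subseteq> S" using S(1,2) open_contains_ball by blast
  show ?thesis
  proof (rule that)
    show "0 < e / 2" using e by simp
    show "\<forall>p \<in> ball 0 (e / 2) \<times> ball 0 (e / 2). complex_differentiable2 f p"
    proof
      fix p :: "complex \<times> complex" assume "p \<in> ball 0 (e / 2) \<times> ball 0 (e / 2)"
      then have "norm (fst p) + norm (snd p) < e" by (auto simp: mem_Times_iff)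
      then have "norm p < e" using norm_Pair_le[of "fst p" "snd p"] by simp
      then have "p \<in> ball 0 e" by simp
      then show "complex_differentiable2 f p" using e S(3) by blast
    qed
  qed
qed

lemma eventually_nhds0_polydisc:
  assumes "0 < (s::real)"
  shows "eventually (\<lambda>p. p \<in> ball 0 s \<times> ball 0 s) (nhds (0 :: complex \<times> complex))"
  by (rule eventually_nhds_in_open) (simp_all add: assms open_Times zero_prod_def)

lemma holomorphic_near0_division_x:
  assumes "holomorphic_near0 f"
  obtains g where "holomorphic_near0 g"
    "eventually (\<lambda>(x, y). f (x, y) = f (0, y) + x * g (x, y)) (nhds 0)"
proof -
  obtain R where R: "0 < R" and diff0: "\<forall>p \<in> ball 0 R \<times> ball 0 R. complex_differentiable2 f p"
    by (rule holomorphic_near0_polydisc[OF assms])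
  note diff = bspec[OF diff0]
  define s where "s = R / 2"
  have s: "0 < s" "s < R" using R by (auto simp: s_def)
  define g where "g = (\<lambda>(x, y). integral {0..1} (\<lambda>t. f (circlepath 0 s t, y) / (circlepath 0 s t - x)))"
  have "holomorphic_near0 g"
    unfolding holomorphic_near0_def g_def
    using eventually_nhds0_polydisc[OF s(1)]
    by (rule eventually_mono) (rule complex_differentiable2_Cauchy_quotient[OF diff s])
  moreover have "eventually (\<lambda>(x, y). f (x, y) = f (0, y) + x * g (x, y)) (nhds 0)"
    using eventually_nhds0_polydisc[OF s(1)]
  proof (rule eventually_mono, clarify)
    fix x y :: complex assume xy: "x \<in> ball 0 s" "y \<in> ball 0 s"
    have "(\<lambda>w. f (w, y)) holomorphic_on cball 0 s"
    proof (rule holomorphic_onI)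
      fix w assume "w \<in> cball (0::complex) s"
      then have "complex_differentiable2 f (w, y)" using xy s by (intro diff) auto
      then show "(\<lambda>w. f (w, y)) field_differentiable at w within cball 0 s"
        by (rule complex_differentiable2_partials)
          (auto simp: field_differentiable_def intro: has_field_derivative_at_within)
    qed
    from Cauchy_difference_quotient[OF this s(1), of x] xy(1)
    show "f (x, y) = f (0, y) + x * g (x, y)"
      by (simp add: g_def algebra_simps)
  qed
  ultimately show ?thesis by (rule that)
qed

section \<open>Taylor coefficients of germs\<close>

lift_definition germ_x :: fgerm is fst .
lift_definition germ_y :: fgerm is snd .

text \<open>One notion covers restriction to either axis, the exchange of the coordinates and
  evaluation at the origin; relations among these reduce to products of 2 by 2 matrices.\<close>

lift_definition pullback :: "complex \<Rightarrow> complex \<Rightarrow> complex \<Rightarrow> complex \<Rightarrow> fgerm \<Rightarrow> fgerm"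
  is "\<lambda>a b c d f (x, y). f (a * x + b * y, c * x + d * y)"
proof -
  fix a b c d :: complex and f g :: "complex \<times> complex \<Rightarrow> complex"
  assume *: "eventually (\<lambda>p. f p = g p) (nhds 0)"
  have "isCont (\<lambda>(x, y). (a * x + b * y, c * x + d * y)) 0"
    unfolding case_prod_unfold by (intro continuous_intros)
  then have "filterlim (\<lambda>(x, y). (a * x + b * y, c * x + d * y)) (nhds 0) (nhds (0 :: complex \<times> complex))"
    by (simp add: isCont_def tendsto_nhds_iff zero_prod_def)
  from eventually_compose_filterlim[OF * this]
  show "eventually (\<lambda>p. (case p of (x, y) \<Rightarrow> f (a * x + b * y, c * x + d * y)) =
      (case p of (x, y) \<Rightarrow> g (a * x + b * y, c * x + d * y))) (nhds 0)"
    by (simp add: case_prod_unfold)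
qed

lemma pullback_add: "pullback a b c d (F + G) = pullback a b c d F + pullback a b c d G"
  and pullback_mult: "pullback a b c d (F * G) = pullback a b c d F * pullback a b c d G"
  and pullback_const [simp]: "pullback a b c d (const_germ k) = const_germ k"
  and pullback_one [simp]: "pullback a b c d 1 = 1"
  and pullback_zero [simp]: "pullback a b c d 0 = 0"
  by (transfer, simp add: case_prod_unfold)+

lemma pullback_germ_x: "pullback a b c d germ_x = const_germ a * germ_x + const_germ b * germ_y"
  and pullback_germ_y: "pullback a b c d germ_y = const_germ c * germ_x + const_germ d * germ_y"
  by (transfer, simp add: case_prod_unfold)+

lemma pullback_pullback: "pullback a b c d (pullback a' b' c' d' F) =
    pullback (a' * a + b' * c) (a' * b + b' * d) (c' * a + d' * c) (c' * b + d' * d) F"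
  by transfer (simp add: case_prod_unfold algebra_simps)

lemma pullback_id: "pullback 1 0 0 1 F = F"
  by transfer (simp add: case_prod_unfold)

lemma pullback_0: "pullback 0 0 0 0 F = const_germ (value0 F)"
  by transfer (simp add: case_prod_unfold zero_prod_def)

lemma value0_germ_x [simp]: "value0 germ_x = 0" and value0_germ_y [simp]: "value0 germ_y = 0"
  by (transfer, simp)+

lemma const_germ_0: "const_germ 0 = 0" and const_germ_1: "const_germ 1 = 1"
  by (transfer, simp)+

lemma const_germ_add: "const_germ (a + b) = const_germ a + const_germ b"
  and const_germ_mult: "const_germ (a * b) = const_germ a * const_germ b"
  and const_germ_minus: "const_germ (- a) = - const_germ a"
  by (transfer, simp)+

lemma complex_differentiable2_linear: "complex_differentiable2 (\<lambda>q. a * fst q + b * snd q) p"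
  unfolding complex_differentiable2_def
  by (intro exI[of _ a] exI[of _ b]) (auto intro!: derivative_eq_intros simp: case_prod_unfold)

lemma germ_x_in_O2: "germ_x \<in> carrier O2" and germ_y_in_O2: "germ_y \<in> carrier O2"
proof -
  have "holomorphic_near0 fst" "holomorphic_near0 snd"
    unfolding holomorphic_near0_def
    using complex_differentiable2_linear[of 1 0] complex_differentiable2_linear[of 0 1]
    by (auto intro: always_eventually)
  then show "germ_x \<in> carrier O2" "germ_y \<in> carrier O2"
    by (simp_all add: germ_x_def germ_y_def germ_in_O2)
qed

lemma pow_in_O2: "F \<in> carrier O2 \<Longrightarrow> F ^ n \<in> carrier O2"
  by (induction n) (auto simp: one_in_O2 mult_in_O2)

lemma diff_in_O2: "F \<in> carrier O2 \<Longrightarrow> G \<in> carrier O2 \<Longrightarrow> F - G \<in> carrier O2"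
  using add_in_O2[of F "- G"] uminus_in_O2[of G] by simp

lemma sum_in_O2: "(\<And>i. i \<in> S \<Longrightarrow> F i \<in> carrier O2) \<Longrightarrow> sum F S \<in> carrier O2"
  by (induction S rule: infinite_finite_induct) (auto simp: zero_in_O2 add_in_O2)

lemmas O2_intros = germ_x_in_O2 germ_y_in_O2 const_in_O2 zero_in_O2 one_in_O2
  add_in_O2 mult_in_O2 uminus_in_O2 diff_in_O2 pow_in_O2 sum_in_O2

lemma pullback_in_O2:
  assumes "F \<in> carrier O2"
  shows "pullback a b c d F \<in> carrier O2"
proof -
  obtain f where f: "holomorphic_near0 f" "F = germ f" using assms by (rule O2_cases)
  let ?T = "\<lambda>(x, y). (a * x + b * y, c * x + d * y) :: complex \<times> complex"
  have "isCont ?T 0" unfolding case_prod_unfold by (intro continuous_intros)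
  then have "filterlim ?T (nhds 0) (nhds 0)"
    by (simp add: isCont_def tendsto_nhds_iff zero_prod_def)
  from eventually_compose_filterlim[OF f(1)[unfolded holomorphic_near0_def] this]
  have "holomorphic_near0 (\<lambda>p. f (?T p))"
    unfolding holomorphic_near0_def
  proof (rule eventually_mono)
    fix p assume "complex_differentiable2 f (?T p)"
    then obtain k l where d: "(f has_derivative (\<lambda>(u, v). k * u + l * v)) (at (?T p))"
      unfolding complex_differentiable2_def by blast
    have "(?T has_derivative ?T) (at p)"
      unfolding case_prod_unfold by (auto intro!: derivative_eq_intros)
    from has_derivative_compose[OF this d]
    have "((\<lambda>p. f (?T p)) has_derivative (\<lambda>(u, v). (k * a + l * c) * u + (k * b + l * d) * v)) (at p)"
      by (simp add: case_prod_unfold algebra_simps)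
    then show "complex_differentiable2 (\<lambda>p. f (?T p)) p"
      unfolding complex_differentiable2_def by blast
  qed
  then have "germ (\<lambda>p. f (?T p)) \<in> carrier O2" by (rule germ_in_O2)
  then show ?thesis unfolding f(2) pullback.abs_eq by (simp add: case_prod_unfold)
qed

text \<open>Off the line x = 0 the factor divides out pointwise; on the line the equality follows by
  continuity.\<close>

lemma germ_x_mult_cancel:
  assumes "F \<in> carrier O2" "G \<in> carrier O2" "germ_x * F = germ_x * G"
  shows "F = G"
proof -
  obtain f where f: "holomorphic_near0 f" "F = germ f" using assms(1) by (rule O2_cases)
  obtain g where g: "holomorphic_near0 g" "G = germ g" using assms(2) by (rule O2_cases)
  have "eventually (\<lambda>p. fst p * f p = fst p * g p) (nhds 0)"
    using assms(3) unfolding f g germ_x_def times_fgerm.abs_eq fgerm.abs_eq_iff .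
  \<comment> \<open>A point on the line x = 0 is approached by points off it, so the identity is
    needed in a whole neighbourhood of each point near 0.\<close>
  then have "eventually (\<lambda>p. eventually (\<lambda>q. fst q * f q = fst q * g q) (nhds p)) (nhds 0)"
    by (simp add: eventually_eventually)
  then have "eventually (\<lambda>p. f p = g p) (nhds 0)"
    using f(1)[unfolded holomorphic_near0_def] g(1)[unfolded holomorphic_near0_def]
  proof eventually_elim
    case (elim p)
    show ?case
    proof (cases "fst p = 0")
      case False
      then show ?thesis using eventually_nhds_x_imp_x[OF elim(1)] by simp
    next
      case True
      obtain y where p: "p = (0, y)" using True by (cases p) auto
      have c: "isCont (\<lambda>q. f q - g q) p"
        by (intro continuous_intros complex_differentiable2_isCont elim)
      have l: "filterlim (\<lambda>t. (t, y)) (nhds p) (at 0)"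
        unfolding p by (intro tendsto_intros)
      have "((\<lambda>t. f (t, y) - g (t, y)) \<longlongrightarrow> f p - g p) (at 0)"
        by (rule isCont_tendsto_compose[OF c l])
      moreover have "eventually (\<lambda>t. t \<noteq> 0) (at (0::complex))" by (simp add: eventually_at_filter)
      then have "eventually (\<lambda>t. f (t, y) - g (t, y) = 0) (at 0)"
        using eventually_compose_filterlim[OF elim(1) l] by eventually_elim simp
      then have "((\<lambda>t. f (t, y) - g (t, y)) \<longlongrightarrow> 0) (at 0)"
        by (rule tendsto_eventually)
      ultimately have "f p - g p = 0" by (intro tendsto_unique) auto
      then show ?thesis by simp
    qed
  qed
  then show ?thesis unfolding f g fgerm.abs_eq_iff .
qed

section \<open>Division operators on germs\<close>

definition restrict_x :: "fgerm \<Rightarrow> fgerm" where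
  "restrict_x = pullback 0 0 0 1"

text \<open>Uniqueness of the quotient is the cancellation of \<open>germ_x\<close>; for
  \<open>F\<close> in \<open>O2\<close> its existence is the Cauchy quotient.\<close>

definition div_x :: "fgerm \<Rightarrow> fgerm" where
  "div_x F = (THE G. G \<in> carrier O2 \<and> F = restrict_x F + germ_x * G)"

lemma div_x_unique:
  assumes "G \<in> carrier O2" "F = restrict_x F + germ_x * G"
  shows "div_x F = G"
  unfolding div_x_def
proof (rule the_equality)
  fix H assume "H \<in> carrier O2 \<and> F = restrict_x F + germ_x * H"
  with assms show "H = G"
    by (metis germ_x_mult_cancel add_left_cancel)
qed (use assms in simp)

lemma div_x:
  assumes "F \<in> carrier O2"
  shows "div_x F \<in> carrier O2" "F = restrict_x F + germ_x * div_x F"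
proof -
  obtain f where f: "holomorphic_near0 f" "F = germ f" using assms by (rule O2_cases)
  obtain g where g: "holomorphic_near0 g"
    "eventually (\<lambda>(x, y). f (x, y) = f (0, y) + x * g (x, y)) (nhds 0)"
    using f(1) by (rule holomorphic_near0_division_x)
  have "F = restrict_x F + germ_x * germ g"
    unfolding f germ_x_def restrict_x_def pullback.abs_eq times_fgerm.abs_eq plus_fgerm.abs_eq
      fgerm.abs_eq_iff
    using g(2) by (simp add: case_prod_unfold)
  moreover from this have "div_x F = germ g"
    using germ_in_O2[OF g(1)] by (intro div_x_unique)
  ultimately show "div_x F \<in> carrier O2" "F = restrict_x F + germ_x * div_x F"
    using germ_in_O2[OF g(1)] by simp_all
qed

definition swap_germ :: "fgerm \<Rightarrow> fgerm" where
  "swap_germ = pullback 0 1 1 0"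

definition restrict_y :: "fgerm \<Rightarrow> fgerm" where
  "restrict_y = pullback 1 0 0 0"

text \<open>Conjugation by the exchange of coordinates transfers the results on \<open>div_x\<close>
  without further analysis.\<close>

definition div_y :: "fgerm \<Rightarrow> fgerm" where
  "div_y F = swap_germ (div_x (swap_germ F))"

lemma swap_swap: "swap_germ (swap_germ F) = F"
  by (simp add: swap_germ_def pullback_pullback pullback_id)

lemma swap_in_O2: "F \<in> carrier O2 \<Longrightarrow> swap_germ F \<in> carrier O2"
  by (simp add: swap_germ_def pullback_in_O2)

lemma swap_germ_x: "swap_germ germ_x = germ_y" and swap_germ_y: "swap_germ germ_y = germ_x"
  by (simp_all add: swap_germ_def pullback_germ_x pullback_germ_y const_germ_0 const_germ_1)

lemma swap_restrict_x: "swap_germ (restrict_x (swap_germ F)) = restrict_y F"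
  by (simp add: swap_germ_def restrict_x_def restrict_y_def pullback_pullback)

lemma swap_add: "swap_germ (F + G) = swap_germ F + swap_germ G"
  and swap_mult: "swap_germ (F * G) = swap_germ F * swap_germ G"
  by (simp_all add: swap_germ_def pullback_add pullback_mult)

lemma div_y:
  assumes "F \<in> carrier O2"
  shows "div_y F \<in> carrier O2" "F = restrict_y F + germ_y * div_y F"
proof -
  show "div_y F \<in> carrier O2"
    unfolding div_y_def by (intro swap_in_O2 div_x assms)
  have "swap_germ (swap_germ F) =
      swap_germ (restrict_x (swap_germ F) + germ_x * div_x (swap_germ F))"
    by (rule arg_cong[OF div_x(2)[OF swap_in_O2[OF assms]]])
  then show "F = restrict_y F + germ_y * div_y F"
    by (simp add: swap_swap swap_add swap_mult swap_germ_x swap_restrict_x div_y_def)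
qed

lemma div_y_unique:
  assumes "G \<in> carrier O2" "F = restrict_y F + germ_y * G"
  shows "div_y F = G"
proof -
  have "swap_germ F = restrict_x (swap_germ F) + germ_x * swap_germ G"
    using arg_cong[OF assms(2), of swap_germ] swap_restrict_x[of F]
    by (metis swap_add swap_mult swap_germ_y swap_swap)
  then have "div_x (swap_germ F) = swap_germ G"
    by (intro div_x_unique swap_in_O2 assms)
  then show ?thesis by (simp add: div_y_def swap_swap)
qed

lemma restrict_simps [simp]:
  "restrict_x (F + G) = restrict_x F + restrict_x G" "restrict_x (F * G) = restrict_x F * restrict_x G"
  "restrict_x (const_germ c) = const_germ c" "restrict_x germ_x = 0" "restrict_x germ_y = germ_y"
  "restrict_x 0 = 0" "restrict_x 1 = 1"
  "restrict_y (F + G) = restrict_y F + restrict_y G" "restrict_y (F * G) = restrict_y F * restrict_y G"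
  "restrict_y (const_germ c) = const_germ c" "restrict_y germ_x = germ_x" "restrict_y germ_y = 0"
  "restrict_y 0 = 0" "restrict_y 1 = 1"
  "restrict_x (restrict_y F) = const_germ (value0 F)"
  "restrict_y (restrict_x F) = const_germ (value0 F)"
  "restrict_x (restrict_x F) = restrict_x F" "restrict_y (restrict_y F) = restrict_y F"
  by (simp_all add: restrict_x_def restrict_y_def pullback_add pullback_mult pullback_germ_x
      pullback_germ_y const_germ_0 const_germ_1 pullback_pullback pullback_0)

lemma restrict_in_O2:
  "F \<in> carrier O2 \<Longrightarrow> restrict_x F \<in> carrier O2" "F \<in> carrier O2 \<Longrightarrow> restrict_y F \<in> carrier O2"
  by (simp_all add: restrict_x_def restrict_y_def pullback_in_O2)

lemma div_x_add: "F \<in> carrier O2 \<Longrightarrow> G \<in> carrier O2 \<Longrightarrow> div_x (F + G) = div_x F + div_x G"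
  using div_x[of F] div_x[of G]
  by (intro div_x_unique) (auto intro: add_in_O2 simp: algebra_simps)

lemma div_y_add: "F \<in> carrier O2 \<Longrightarrow> G \<in> carrier O2 \<Longrightarrow> div_y (F + G) = div_y F + div_y G"
  using div_y[of F] div_y[of G]
  by (intro div_y_unique) (auto intro: add_in_O2 simp: algebra_simps)

text \<open>The condition \<open>restrict_x H = H\<close> says that H does not depend on x, so H
  behaves like a scalar for division by x.\<close>

lemma div_x_mult:
  assumes "F \<in> carrier O2" "H \<in> carrier O2" "restrict_x H = H"
  shows "div_x (H * F) = H * div_x F"
proof (rule div_x_unique)
  have "H * F = H * (restrict_x F + germ_x * div_x F)" by (rule arg_cong[OF div_x(2)[OF assms(1)]])
  then show "H * F = restrict_x (H * F) + germ_x * (H * div_x F)"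
    using assms(3) by (simp add: algebra_simps)
qed (intro mult_in_O2 div_x assms)

lemma div_y_mult:
  assumes "F \<in> carrier O2" "H \<in> carrier O2" "restrict_y H = H"
  shows "div_y (H * F) = H * div_y F"
proof (rule div_y_unique)
  have "H * F = H * (restrict_y F + germ_y * div_y F)" by (rule arg_cong[OF div_y(2)[OF assms(1)]])
  then show "H * F = restrict_y (H * F) + germ_y * (H * div_y F)"
    using assms(3) by (simp add: algebra_simps)
qed (intro mult_in_O2 div_y assms)

lemma div_x_germ_x_mult: "F \<in> carrier O2 \<Longrightarrow> div_x (germ_x * F) = F"
  by (rule div_x_unique) simp_all

lemma div_y_germ_y_mult: "F \<in> carrier O2 \<Longrightarrow> div_y (germ_y * F) = F"
  by (rule div_y_unique) simp_all

lemma div_x_const: "div_x (const_germ c) = 0" and div_y_const: "div_y (const_germ c) = 0"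
  by (intro div_x_unique div_y_unique zero_in_O2; simp)+

lemma funpow_div_x_in_O2: "F \<in> carrier O2 \<Longrightarrow> (div_x ^^ n) F \<in> carrier O2"
  and funpow_div_y_in_O2: "F \<in> carrier O2 \<Longrightarrow> (div_y ^^ n) F \<in> carrier O2"
  by (induction n) (auto intro: div_x div_y)

lemma funpow_div_x_mult:
  assumes "F \<in> carrier O2" "H \<in> carrier O2" "restrict_x H = H"
  shows "(div_x ^^ n) (H * F) = H * (div_x ^^ n) F"
  using assms by (induction n) (auto simp: div_x_mult funpow_div_x_in_O2)

lemma funpow_div_y_mult:
  assumes "F \<in> carrier O2" "H \<in> carrier O2" "restrict_y H = H"
  shows "(div_y ^^ n) (H * F) = H * (div_y ^^ n) F"
  using assms by (induction n) (auto simp: div_y_mult funpow_div_y_in_O2)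

lemma funpow_div_x_add: "F \<in> carrier O2 \<Longrightarrow> G \<in> carrier O2 \<Longrightarrow>
    (div_x ^^ n) (F + G) = (div_x ^^ n) F + (div_x ^^ n) G"
  by (induction n) (auto simp: div_x_add funpow_div_x_in_O2)

lemma funpow_div_y_add: "F \<in> carrier O2 \<Longrightarrow> G \<in> carrier O2 \<Longrightarrow>
    (div_y ^^ n) (F + G) = (div_y ^^ n) F + (div_y ^^ n) G"
  by (induction n) (auto simp: div_y_add funpow_div_y_in_O2)

text \<open>The coefficient of x^i y^j, free of derivatives and factorials; multiplication by a
  monomial merely shifts the indices.\<close>

definition taylor_coeff :: "nat \<Rightarrow> nat \<Rightarrow> fgerm \<Rightarrow> complex" where
  "taylor_coeff i j F = value0 ((div_x ^^ i) ((div_y ^^ j) F))"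

lemma taylor_coeff_add: "F \<in> carrier O2 \<Longrightarrow> G \<in> carrier O2 \<Longrightarrow>
    taylor_coeff i j (F + G) = taylor_coeff i j F + taylor_coeff i j G"
  by (simp add: taylor_coeff_def funpow_div_y_add funpow_div_x_add funpow_div_y_in_O2)

lemma taylor_coeff_const_mult: "F \<in> carrier O2 \<Longrightarrow>
    taylor_coeff i j (const_germ c * F) = c * taylor_coeff i j F"
  by (simp add: taylor_coeff_def funpow_div_y_mult funpow_div_x_mult funpow_div_y_in_O2 const_in_O2)

lemma taylor_coeff_germ_x_mult:
  assumes "F \<in> carrier O2"
  shows "taylor_coeff i j (germ_x * F) = (case i of 0 \<Rightarrow> 0 | Suc i \<Rightarrow> taylor_coeff i j F)"
  using assms
  by (cases i) (simp_all add: taylor_coeff_def funpow_div_y_mult funpow_div_y_in_O2 germ_x_in_O2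
      div_x_germ_x_mult funpow_swap1 del: funpow.simps(2) add: funpow_Suc_right)

lemma taylor_coeff_germ_y_mult:
  assumes "F \<in> carrier O2"
  shows "taylor_coeff i j (germ_y * F) = (case j of 0 \<Rightarrow> 0 | Suc j \<Rightarrow> taylor_coeff i j F)"
  using assms
  by (cases j) (simp_all add: taylor_coeff_def funpow_div_x_mult germ_y_in_O2
      div_y_germ_y_mult del: funpow.simps(2) add: funpow_Suc_right)

lemma taylor_coeff_const: "taylor_coeff i j (const_germ c) = (if i = 0 \<and> j = 0 then c else 0)"
proof -
  have 0: "div_x 0 = 0" "div_y 0 = 0"
    using div_x_const[of 0] div_y_const[of 0] by (simp_all add: const_germ_0)
  have x0: "(div_x ^^ n) 0 = 0" and y0: "(div_y ^^ n) 0 = 0" for n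
    by (induction n) (simp_all add: 0)
  show ?thesis
    by (cases i; cases j)
      (simp_all add: taylor_coeff_def div_x_const div_y_const 0 x0 y0 del: funpow.simps(2) add: funpow_Suc_right)
qed

text \<open>The factor \<open>F\<close> is arbitrary because a functional that vanishes on an ideal
  has to kill every multiple of a generator.\<close>

lemma taylor_coeff_monomial_mult:
  assumes "F \<in> carrier O2"
  shows "taylor_coeff i j (germ_x ^ a * germ_y ^ b * F) =
    (if a \<le> i \<and> b \<le> j then taylor_coeff (i - a) (j - b) F else 0)"
proof (induction a arbitrary: i)
  case 0
  show ?case
  proof (induction b arbitrary: j)
    case (Suc b)
    have "germ_x ^ 0 * germ_y ^ Suc b * F = germ_y * (germ_x ^ 0 * germ_y ^ b * F)" by (simp add: algebra_simps)
    then have "taylor_coeff i j (germ_x ^ 0 * germ_y ^ Suc b * F) =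
        (case j of 0 \<Rightarrow> 0 | Suc j \<Rightarrow> taylor_coeff i j (germ_x ^ 0 * germ_y ^ b * F))"
      using assms by (simp only:) (intro taylor_coeff_germ_y_mult O2_intros)
    then show ?case using Suc.IH by (simp split: nat.split)
  qed simp
next
  case (Suc a)
  have "germ_x ^ Suc a * germ_y ^ b * F = germ_x * (germ_x ^ a * germ_y ^ b * F)" by (simp add: algebra_simps)
  then have "taylor_coeff i j (germ_x ^ Suc a * germ_y ^ b * F) =
      (case i of 0 \<Rightarrow> 0 | Suc i \<Rightarrow> taylor_coeff i j (germ_x ^ a * germ_y ^ b * F))"
    using assms by (simp only:) (intro taylor_coeff_germ_x_mult O2_intros)
  then show ?case using Suc.IH by (simp split: nat.split)
qed

text \<open>A germ free of y restricts to a constant on x = 0, so each division by x splits off one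
  scalar.\<close>

lemma taylor_expand_x:
  assumes "F \<in> carrier O2" "restrict_y F = F"
  shows "\<exists>A \<in> carrier O2. F = (\<Sum>i<n. const_germ (value0 ((div_x ^^ i) F)) * germ_x ^ i) + germ_x ^ n * A"
  using assms
proof (induction n arbitrary: F)
  case 0
  then show ?case by auto
next
  case (Suc n)
  define G where "G = div_x F"
  have G: "G \<in> carrier O2" unfolding G_def by (rule div_x) fact
  have r: "restrict_x F = const_germ (value0 F)" using restrict_simps(15)[of F] Suc.prems(2) by simp
  have F: "F = const_germ (value0 F) + germ_x * G"
    using div_x(2)[OF Suc.prems(1)] unfolding r G_def .
  \<comment> \<open>The quotient is again free of y: restrict the decomposition to y = 0, compare
    and cancel x. This keeps the induction going.\<close>
  have "restrict_y F = const_germ (value0 F) + germ_x * restrict_y G"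
    using arg_cong[OF F, of restrict_y] by simp
  also have "restrict_y F = const_germ (value0 F) + germ_x * G"
    unfolding Suc.prems(2) by (rule F)
  finally have "germ_x * restrict_y G = germ_x * G" by simp
  then have "restrict_y G = G"
    by (rule germ_x_mult_cancel[OF restrict_in_O2(2)[OF G] G])
  have "\<exists>A \<in> carrier O2. G = (\<Sum>i<n. const_germ (value0 ((div_x ^^ i) G)) * germ_x ^ i) + germ_x ^ n * A"
    by (rule Suc.IH) fact+
  then obtain A where A: "A \<in> carrier O2"
    "G = (\<Sum>i<n. const_germ (value0 ((div_x ^^ i) G)) * germ_x ^ i) + germ_x ^ n * A"
    by (rule bexE)
  let ?c = "const_germ (value0 F)"
  have "F = ?c + germ_x * G" by (rule F)
  also have "\<dots> = ?c +
      germ_x * ((\<Sum>i<n. const_germ (value0 ((div_x ^^ i) G)) * germ_x ^ i) + germ_x ^ n * A)"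
    by (rule arg_cong[OF A(2), of "\<lambda>H. ?c + germ_x * H"])
  also have "\<dots> = (\<Sum>i<Suc n. const_germ (value0 ((div_x ^^ i) F)) * germ_x ^ i) + germ_x ^ Suc n * A"
    unfolding sum.lessThan_Suc_shift G_def
    by (simp add: algebra_simps sum_distrib_left funpow_swap1)
  finally show ?case using A(1) by blast
qed

text \<open>The part \<open>germ_y * div_y F\<close> has no coefficient with j = 0, so the
  coefficients of \<open>restrict_y F\<close> are those of \<open>F\<close> itself.\<close>

lemma taylor_expand_row:
  assumes "F \<in> carrier O2"
  shows "\<exists>A \<in> carrier O2. F =
    (\<Sum>i<n. const_germ (taylor_coeff i 0 F) * germ_x ^ i) + germ_x ^ n * A + germ_y * div_y F"
proof -
  note F = div_y[OF assms]
  have R: "restrict_y F \<in> carrier O2" using assms by (rule restrict_in_O2)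
  have "taylor_coeff i 0 F = taylor_coeff i 0 (restrict_y F + germ_y * div_y F)" for i
    by (rule arg_cong[OF F(2)])
  also have "taylor_coeff i 0 (restrict_y F + germ_y * div_y F) = taylor_coeff i 0 (restrict_y F)" for i
    using R F(1) by (simp add: taylor_coeff_add taylor_coeff_germ_y_mult mult_in_O2 germ_y_in_O2)
  finally have c: "value0 ((div_x ^^ i) (restrict_y F)) = taylor_coeff i 0 F" for i
    by (simp add: taylor_coeff_def)
  from taylor_expand_x[OF R, of n] obtain A where A: "A \<in> carrier O2"
    "restrict_y F = (\<Sum>i<n. const_germ (taylor_coeff i 0 F) * germ_x ^ i) + germ_x ^ n * A"
    unfolding c by auto
  from F(2) A show ?thesis by metis
qed

text \<open>The row length \<open>n j\<close> may vary with j, so that the finite part can follow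
  the staircase below a monomial ideal.\<close>

lemma taylor_expand:
  assumes "F \<in> carrier O2"
  obtains A B where "\<And>j. A j \<in> carrier O2" "B \<in> carrier O2"
    "F = (\<Sum>j<m. ((\<Sum>i<n j. const_germ (taylor_coeff i j F) * germ_x ^ i) + germ_x ^ n j * A j) * germ_y ^ j)
      + B * germ_y ^ m"
proof -
  have "\<exists>A. A \<in> carrier O2 \<and> (div_y ^^ j) F =
    (\<Sum>i<n j. const_germ (taylor_coeff i j F) * germ_x ^ i) + germ_x ^ n j * A + germ_y * (div_y ^^ Suc j) F" for j
    using taylor_expand_row[OF funpow_div_y_in_O2[OF assms, of j], of "n j"]
    by (auto simp: taylor_coeff_def)
  from choice[OF allI[OF this]]
  obtain A where A0: "\<forall>j. A j \<in> carrier O2 \<and> (div_y ^^ j) F =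
    (\<Sum>i<n j. const_germ (taylor_coeff i j F) * germ_x ^ i) + germ_x ^ n j * A j + germ_y * (div_y ^^ Suc j) F" ..
  note A = conjunct1[OF spec[OF A0]] conjunct2[OF spec[OF A0]]
  have "F = (\<Sum>j<m. ((\<Sum>i<n j. const_germ (taylor_coeff i j F) * germ_x ^ i) + germ_x ^ n j * A j) * germ_y ^ j)
      + (div_y ^^ m) F * germ_y ^ m"
  proof (induction m)
    case (Suc m)
    let ?r = "\<lambda>j. (\<Sum>i<n j. const_germ (taylor_coeff i j F) * germ_x ^ i) + germ_x ^ n j * A j"
    have "(div_y ^^ m) F * germ_y ^ m = (?r m + germ_y * (div_y ^^ Suc m) F) * germ_y ^ m"
      using A(2)[of m] by (rule arg_cong)
    also have "\<dots> = ?r m * germ_y ^ m + (div_y ^^ Suc m) F * germ_y ^ Suc m"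
      unfolding power_Suc distrib_right by (simp only: ac_simps)
    finally show ?case using Suc.IH unfolding sum.lessThan_Suc by (simp only: add.assoc)
  qed simp
  then show ?thesis by (rule that[OF A(1) funpow_div_y_in_O2[OF assms]])
qed

section \<open>Dimensions of quotients and the first Tjurina ideal\<close>

lemma O2_a_inv: "F \<in> carrier O2 \<Longrightarrow> \<ominus>\<^bsub>O2\<^esub> F = - F"
proof -
  assume F: "F \<in> carrier O2"
  interpret cring O2 by (rule cring_O2)
  show ?thesis by (rule minus_equality) (use F uminus_in_O2 in auto)
qed

lemma O2_minus: "F \<in> carrier O2 \<Longrightarrow> G \<in> carrier O2 \<Longrightarrow> F \<ominus>\<^bsub>O2\<^esub> G = F - G"
  by (simp add: a_minus_def O2_a_inv)

lemma ideal_O2_closed: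
  assumes "ideal I O2"
  shows "F \<in> I \<Longrightarrow> F \<in> carrier O2" "0 \<in> I"
    "F \<in> I \<Longrightarrow> G \<in> I \<Longrightarrow> F + G \<in> I" "F \<in> I \<Longrightarrow> G \<in> I \<Longrightarrow> F - G \<in> I"
    "F \<in> I \<Longrightarrow> H \<in> carrier O2 \<Longrightarrow> H * F \<in> I"
proof -
  interpret I: ideal I O2 by fact
  show c: "F \<in> I \<Longrightarrow> F \<in> carrier O2" for F by (rule I.Icarr)
  show "0 \<in> I" using additive_subgroup.zero_closed[OF ideal.axioms(1)[OF assms]] by simp
  show a: "F \<in> I \<Longrightarrow> G \<in> I \<Longrightarrow> F + G \<in> I" for F G using additive_subgroup.a_closed[OF ideal.axioms(1)[OF assms], of F G] by simp
  show "F \<in> I \<Longrightarrow> H \<in> carrier O2 \<Longrightarrow> H * F \<in> I" using I.I_l_closed[of F H] by simp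
  show "F \<in> I \<Longrightarrow> G \<in> I \<Longrightarrow> F - G \<in> I"
    using a[of F "- G"] additive_subgroup.a_inv_closed[OF ideal.axioms(1)[OF assms], of G] c[of G] by (simp add: O2_a_inv)
qed

text \<open>The image of this subfield in a quotient ring is the field of scalars over which the
  dimension is taken.\<close>

lemma subfield_const_germ: "subfield (range const_germ) O2"
proof -
  interpret cring O2 by (rule cring_O2)
  have inj: "const_germ c = 0 \<longleftrightarrow> c = 0" for c
    using value0_simps(3)[of c] by (metis const_germ_0 value0_simps(1))
  show ?thesis
  proof (rule subfieldI)
    show "subcring (range const_germ) O2"
    proof (intro subcringI' subringI)
      fix h assume "h \<in> range const_germ"
      then show "\<ominus>\<^bsub>O2\<^esub> h \<in> range const_germ"
        by (auto simp: O2_a_inv const_in_O2 simp flip: const_germ_minus)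
    qed (auto simp: const_in_O2 simp flip: const_germ_add const_germ_mult const_germ_1)
    show "Units (O2\<lparr>carrier := range const_germ\<rparr>) = range const_germ - {\<zero>\<^bsub>O2\<^esub>}"
    proof
      show "Units (O2\<lparr>carrier := range const_germ\<rparr>) \<subseteq> range const_germ - {\<zero>\<^bsub>O2\<^esub>}"
        by (auto simp: Units_def)
      show "range const_germ - {\<zero>\<^bsub>O2\<^esub>} \<subseteq> Units (O2\<lparr>carrier := range const_germ\<rparr>)"
      proof
        fix k assume "k \<in> range const_germ - {\<zero>\<^bsub>O2\<^esub>}"
        then obtain c where c: "k = const_germ c" "c \<noteq> 0" by (auto simp: inj const_germ_0)
        then have "const_germ (inverse c) * k = 1" "k * const_germ (inverse c) = 1"
          by (simp_all flip: const_germ_mult add: const_germ_1)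
        then show "k \<in> Units (O2\<lparr>carrier := range const_germ\<rparr>)"
          using c(1) by (auto simp: Units_def)
      qed
    qed
  qed
qed

text \<open>The forms vanish on \<open>I\<close> and thus descend to the quotient. Duality makes the
  classes of the \<open>b s\<close> independent, and \<open>span\<close> makes them
  generate.\<close>

lemma quotient_dim_eq_card:
  fixes S :: "'i set" and b :: "'i \<Rightarrow> fgerm" and \<phi> :: "'i \<Rightarrow> fgerm \<Rightarrow> complex"
  assumes I: "ideal I O2" and S: "finite S" "S \<noteq> {}"
    and b: "\<And>s. s \<in> S \<Longrightarrow> b s \<in> carrier O2"
    and add: "\<And>s F G. s \<in> S \<Longrightarrow> F \<in> carrier O2 \<Longrightarrow> G \<in> carrier O2 \<Longrightarrow> \<phi> s (F + G) = \<phi> s F + \<phi> s G"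
    and scale: "\<And>s c F. s \<in> S \<Longrightarrow> F \<in> carrier O2 \<Longrightarrow> \<phi> s (const_germ c * F) = c * \<phi> s F"
    and dual: "\<And>s t. s \<in> S \<Longrightarrow> t \<in> S \<Longrightarrow> \<phi> s (b t) = (if s = t then 1 else 0)"
    and vanish: "\<And>s F. s \<in> S \<Longrightarrow> F \<in> I \<Longrightarrow> \<phi> s F = 0"
    and span: "\<And>F. F \<in> carrier O2 \<Longrightarrow> F - (\<Sum>s\<in>S. const_germ (\<phi> s F) * b s) \<in> I"
  shows "quotient_dim I = enat (card S)"
proof -
  interpret cring O2 by (rule cring_O2)
  interpret I: ideal I O2 by (rule I)
  define Q where "Q = O2 Quot I"
  define cl where "cl = (\<lambda>F. I +>\<^bsub>O2\<^esub> F)"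
  define K where "K = range (\<lambda>c. cl (const_germ c))"
  have hom: "ring_hom_ring O2 Q cl" unfolding Q_def cl_def by (rule I.rcos_ring_hom_ring)
  interpret h: ring_hom_ring O2 Q cl by (rule hom)
  have carrQ: "carrier Q = cl ` carrier O2"
    by (auto simp: Q_def cl_def FactRing_def A_RCOSETS_def')
  have cl_eq: "cl F = cl G \<longleftrightarrow> F - G \<in> I" if "F \<in> carrier O2" "G \<in> carrier O2" for F G
    using quotient_eq_iff_same_a_r_cos[OF I that] that by (simp add: cl_def O2_minus)
  have cl_add: "cl F \<oplus>\<^bsub>Q\<^esub> cl G = cl (F + G)" and cl_mult: "cl F \<otimes>\<^bsub>Q\<^esub> cl G = cl (F * G)"
    if "F \<in> carrier O2" "G \<in> carrier O2" for F G
    using h.hom_add[OF that] h.hom_mult[OF that] by simp_all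
  have \<phi>sum: "\<phi> s (\<Sum>t\<in>T. const_germ (c t) * b t) = (if s \<in> T then c s else 0)"
    if "s \<in> S" "T \<subseteq> S" for s T c
  proof -
    have "finite T" using that(2) S(1) by (rule finite_subset)
    then show ?thesis using that(2)
    proof (induction T)
      case empty
      have "\<phi> s (const_germ 0 * 0) = 0" unfolding scale[OF that(1) zero_in_O2] by simp
      then show ?case by simp
    next
      case (insert t T)
      then show ?case using that(1)
        by (auto simp: add scale dual b mult_in_O2 const_in_O2 sum_in_O2 subset_iff)
    qed
  qed
  have sum_O2: "(\<Sum>t\<in>T. const_germ (c t) * b t) \<in> carrier O2" if "T \<subseteq> S" for T c
    using that by (intro sum_in_O2 mult_in_O2 const_in_O2 b) auto
  define E where "E = (\<lambda>T. {cl (\<Sum>t\<in>T. const_germ (c t) * b t) | c. True})"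
  \<comment> \<open>If 1 were in \<open>I\<close>, so would be some \<open>b s\<close>, on which
    \<open>\<phi> s\<close> is 1 and not 0. The quotient has to be nontrivial for the constants to
    embed as a field.\<close>
  have one: "\<one>\<^bsub>Q\<^esub> \<noteq> \<zero>\<^bsub>Q\<^esub>"
  proof
    assume "\<one>\<^bsub>Q\<^esub> = \<zero>\<^bsub>Q\<^esub>"
    then have "cl 1 = cl 0" using h.hom_one h.hom_zero by simp
    then have "1 \<in> I" using cl_eq[OF one_in_O2 zero_in_O2] by simp
    obtain s where s: "s \<in> S" using S(2) by blast
    have "b s * 1 \<in> I" by (rule ideal_O2_closed(5)[OF I \<open>1 \<in> I\<close> b[OF s]])
    then show False using vanish[OF s] dual[OF s s] by simp
  qed
  have K: "subfield K Q"
    using h.img_is_subfield(2)[OF subfield_const_germ one] by (simp add: K_def image_image)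
  have dim: "T \<subseteq> S \<Longrightarrow> ring.dimension Q (card T) K (E T)" if "finite T" for T
    using that
  proof (induction T)
    case empty
    have "E {} = {\<zero>\<^bsub>Q\<^esub>}" using h.hom_zero by (auto simp: E_def)
    then show ?case by (simp add: h.S.dimension.zero_dim)
  next
    case (insert t T)
    have t: "t \<in> S" "T \<subseteq> S" using insert.prems by auto
    \<comment> \<open>\<open>E T\<close> is the span of the classes of the \<open>b s\<close> with s
      in T. The form \<open>\<phi> t\<close> vanishes on it but not at \<open>b t\<close>, so each
      new index raises the dimension by one.\<close>
    have "cl (b t) \<notin> E T"
    proof
      assume "cl (b t) \<in> E T"
      then obtain c where "cl (b t) = cl (\<Sum>t\<in>T. const_germ (c t) * b t)" by (auto simp: E_def)
      then have "b t - (\<Sum>t\<in>T. const_germ (c t) * b t) \<in> I"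
        using cl_eq b sum_O2 t by simp
      then have "\<phi> t (b t - (\<Sum>t\<in>T. const_germ (c t) * b t)) = 0" by (rule vanish[OF t(1)])
      moreover have "\<phi> t (b t - (\<Sum>t\<in>T. const_germ (c t) * b t) + (\<Sum>t\<in>T. const_germ (c t) * b t)) =
          \<phi> t (b t - (\<Sum>t\<in>T. const_germ (c t) * b t)) + \<phi> t (\<Sum>t\<in>T. const_germ (c t) * b t)"
        by (intro add diff_in_O2 b sum_O2 t)
      ultimately show False
        using \<phi>sum[OF t, of c] dual[OF t(1) t(1)] insert.hyps(2) by simp
    qed
    moreover have "E (insert t T) = h.S.line_extension K (cl (b t)) (E T)"
    proof
      show "E (insert t T) \<subseteq> h.S.line_extension K (cl (b t)) (E T)"
      proof
        fix u assume "u \<in> E (insert t T)"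
        then obtain c where "u = cl (const_germ (c t) * b t + (\<Sum>t\<in>T. const_germ (c t) * b t))"
          using insert.hyps by (auto simp: E_def)
        then have "u = cl (const_germ (c t)) \<otimes>\<^bsub>Q\<^esub> cl (b t) \<oplus>\<^bsub>Q\<^esub> cl (\<Sum>t\<in>T. const_germ (c t) * b t)"
          using t by (simp add: cl_add cl_mult const_in_O2 b sum_O2 mult_in_O2)
        then show "u \<in> h.S.line_extension K (cl (b t)) (E T)"
          unfolding h.S.line_extension_mem_iff K_def E_def by blast
      qed
      show "h.S.line_extension K (cl (b t)) (E T) \<subseteq> E (insert t T)"
      proof
        fix u assume "u \<in> h.S.line_extension K (cl (b t)) (E T)"
        then obtain k c where u: "u = cl (const_germ k) \<otimes>\<^bsub>Q\<^esub> cl (b t) \<oplus>\<^bsub>Q\<^esub> cl (\<Sum>t\<in>T. const_germ (c t) * b t)"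
          unfolding h.S.line_extension_mem_iff K_def E_def by blast
        have "(\<Sum>s\<in>T. const_germ ((c(t := k)) s) * b s) = (\<Sum>s\<in>T. const_germ (c s) * b s)"
          using insert.hyps(2) by (intro sum.cong) auto
        then have "u = cl (\<Sum>s\<in>insert t T. const_germ ((c(t := k)) s) * b s)"
          using t insert.hyps by (simp add: u cl_add cl_mult const_in_O2 b sum_O2 mult_in_O2)
        then show "u \<in> E (insert t T)" unfolding E_def by blast
      qed
    qed
    ultimately show ?case
      using h.S.dimension.Suc_dim[of "cl (b t)" "E T" "card T" K] insert.IH t insert.hyps b[OF t(1)] by simp
  qed
  have "E S = carrier Q"
  proof
    show "E S \<subseteq> carrier Q" unfolding E_def carrQ using sum_O2[OF order_refl] by blast
    show "carrier Q \<subseteq> E S"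
    proof
      fix u assume "u \<in> carrier Q"
      then obtain F where F: "F \<in> carrier O2" "u = cl F" unfolding carrQ by blast
      then have "u = cl (\<Sum>s\<in>S. const_germ (\<phi> s F) * b s)"
        using span[OF F(1)] cl_eq[OF F(1) sum_O2[OF order_refl]] by simp
      then show "u \<in> E S"
        unfolding E_def by (intro CollectI exI[of _ "\<lambda>s. \<phi> s F"] conjI TrueI)
    qed
  qed
  with dim[OF S(1) order_refl] have D: "h.S.dimension (card S) K (carrier Q)" by simp
  have "h.S.finite_dimension K (carrier Q)" "h.S.dim K (carrier Q) = card S"
    using h.S.finite_dimensionI[OF D] h.S.dimI[OF K D] by (simp_all add: over_def)
  then show ?thesis
    unfolding quotient_dim_def Let_def Q_def[symmetric] cl_def[symmetric] K_def[symmetric] by simp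
qed

section \<open>Generators of the first Tjurina ideal\<close>

lemma tjurina_ideal_1:
  "tjurina_ideal 1 F = (max_ideal \<cdot>\<^bsub>O2\<^esub> (Idl\<^bsub>O2\<^esub> {partial_x F, partial_y F})) <+>\<^bsub>O2\<^esub> (PIdl\<^bsub>O2\<^esub> F)"
proof -
  interpret cring O2 by (rule cring_O2)
  interpret M: comm_monoid "ideals_set O2" by (rule ideals_set_is_comm_monoid)
  have "max_ideal \<in> carrier (ideals_set O2)" using ideal_max_ideal by (simp add: ideals_set_def)
  then have "max_ideal [^]\<^bsub>ideals_set O2\<^esub> (1::nat) = max_ideal" by (rule M.nat_pow_eone)
  then show ?thesis by (simp only: tjurina_ideal_def jacobian_ideal_def)
qed

lemma ideal_tjurina_ideal_1:
  assumes "F \<in> carrier O2" "partial_x F \<in> carrier O2" "partial_y F \<in> carrier O2"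
  shows "ideal (tjurina_ideal 1 F) O2"
proof -
  interpret cring O2 by (rule cring_O2)
  show ?thesis
    unfolding tjurina_ideal_1 using assms
    by (intro add_ideals ideal_prod_is_ideal ideal_max_ideal genideal_ideal cgenideal_ideal) auto
qed

lemma tjurina_ideal_1_generators:
  assumes "F \<in> carrier O2" "partial_x F \<in> carrier O2" "partial_y F \<in> carrier O2"
  shows "F \<in> tjurina_ideal 1 F"
    "a \<in> max_ideal \<Longrightarrow> a * partial_x F \<in> tjurina_ideal 1 F"
    "a \<in> max_ideal \<Longrightarrow> a * partial_y F \<in> tjurina_ideal 1 F"
proof -
  interpret cring O2 by (rule cring_O2)
  let ?J = "Idl\<^bsub>O2\<^esub> {partial_x F, partial_y F}"
  have J: "ideal ?J O2" "partial_x F \<in> ?J" "partial_y F \<in> ?J"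
    using genideal_ideal[of "{partial_x F, partial_y F}"] genideal_self[of "{partial_x F, partial_y F}"] assms by auto
  interpret P: ideal "max_ideal \<cdot>\<^bsub>O2\<^esub> ?J" O2 by (rule ideal_prod_is_ideal[OF ideal_max_ideal J(1)])
  interpret C: ideal "PIdl\<^bsub>O2\<^esub> F" O2 by (rule cgenideal_ideal[OF assms(1)])
  have "0 + F \<in> tjurina_ideal 1 F"
    unfolding tjurina_ideal_1 set_add_def' using additive_subgroup.zero_closed[OF P.additive_subgroup_axioms] cgenideal_self[OF assms(1)] by force
  then show "F \<in> tjurina_ideal 1 F" by simp
  have "a * q + 0 \<in> tjurina_ideal 1 F" if "a \<in> max_ideal" "q \<in> ?J" for a q
    unfolding tjurina_ideal_1 set_add_def' using additive_subgroup.zero_closed[OF C.additive_subgroup_axioms] ideal_prod.prod[OF that, of O2] by force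
  then show "a \<in> max_ideal \<Longrightarrow> a * partial_x F \<in> tjurina_ideal 1 F"
    "a \<in> max_ideal \<Longrightarrow> a * partial_y F \<in> tjurina_ideal 1 F"
    using J by simp_all
qed

text \<open>Division by x leaves the restriction to x = 0, which vanishes at the origin and is
  therefore divisible by y.\<close>

lemma max_ideal_decompose:
  assumes "a \<in> max_ideal"
  obtains A B where "A \<in> carrier O2" "B \<in> carrier O2" "a = germ_x * A + germ_y * B"
proof -
  have a: "a \<in> carrier O2" "value0 a = 0" using assms by (auto simp: max_ideal_def)
  have "restrict_x a = restrict_y (restrict_x a) + germ_y * div_y (restrict_x a)"
    by (rule div_y(2)[OF restrict_in_O2(1)[OF a(1)]])
  then have "restrict_x a = germ_y * div_y (restrict_x a)"
    by (simp add: a(2) const_germ_0)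
  with div_x(2)[OF a(1)] have "a = germ_x * div_x a + germ_y * div_y (restrict_x a)"
    by (metis add.commute)
  with that div_x(1)[OF a(1)] div_y(1)[OF restrict_in_O2(1)[OF a(1)]] show ?thesis by blast
qed

text \<open>Since m = (x, y), the ideal is generated by four products of a coordinate with a partial
  derivative, together with F. As \<open>\<phi>\<close> is only additive, every multiple of each
  generator is tested.\<close>

lemma vanish_on_tjurina_ideal_1:
  fixes \<phi> :: "fgerm \<Rightarrow> complex"
  assumes F: "F \<in> carrier O2" "partial_x F \<in> carrier O2" "partial_y F \<in> carrier O2"
    and add: "\<And>G H. G \<in> carrier O2 \<Longrightarrow> H \<in> carrier O2 \<Longrightarrow> \<phi> (G + H) = \<phi> G + \<phi> H"
    and x: "\<And>G. G \<in> carrier O2 \<Longrightarrow> \<phi> (G * germ_x * partial_x F) = 0" "\<And>G. G \<in> carrier O2 \<Longrightarrow> \<phi> (G * germ_y * partial_x F) = 0"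
    and y: "\<And>G. G \<in> carrier O2 \<Longrightarrow> \<phi> (G * germ_x * partial_y F) = 0" "\<And>G. G \<in> carrier O2 \<Longrightarrow> \<phi> (G * germ_y * partial_y F) = 0"
    and f: "\<And>G. G \<in> carrier O2 \<Longrightarrow> \<phi> (G * F) = 0"
    and H: "H \<in> tjurina_ideal 1 F"
  shows "\<phi> H = 0"
proof -
  interpret cring O2 by (rule cring_O2)
  let ?J = "Idl\<^bsub>O2\<^esub> {partial_x F, partial_y F}"
  \<comment> \<open>The elements q for which \<open>\<phi>\<close> kills all multiples of xq and yq
    form an ideal. It contains both partial derivatives, hence the Jacobian ideal.\<close>
  define T where "T = {q \<in> carrier O2. \<forall>G \<in> carrier O2. \<phi> (G * germ_x * q) = 0 \<and> \<phi> (G * germ_y * q) = 0}"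
  have "ideal T O2"
  proof (rule idealI)
    show "ring O2" by (rule ring_axioms)
    show "subgroup T (add_monoid O2)"
    proof (rule add.subgroupI)
      show "T \<noteq> {}" using F x y by (auto simp: T_def)
    next
      fix q assume q: "q \<in> T"
      then have qc: "q \<in> carrier O2" by (simp add: T_def)
      have "\<phi> (G * germ_x * - q) = 0 \<and> \<phi> (G * germ_y * - q) = 0" if "G \<in> carrier O2" for G
      proof -
        have "\<phi> (- G * germ_x * q) = 0 \<and> \<phi> (- G * germ_y * q) = 0"
          using q uminus_in_O2[OF that] by (auto simp: T_def)
        then show ?thesis by simp
      qed
      then show "\<ominus>\<^bsub>O2\<^esub> q \<in> T" using qc by (simp add: O2_a_inv T_def uminus_in_O2)
    next
      fix p q assume "p \<in> T" "q \<in> T"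
      then show "p \<oplus>\<^bsub>O2\<^esub> q \<in> T"
        by (auto simp: T_def distrib_left add O2_intros)
    qed (auto simp: T_def)
  next
    fix q H assume q: "q \<in> T" and H: "H \<in> carrier O2"
    have "\<phi> (G * germ_x * (H * q)) = 0 \<and> \<phi> (G * germ_y * (H * q)) = 0" if "G \<in> carrier O2" for G
    proof -
      have "\<phi> ((G * H) * germ_x * q) = 0 \<and> \<phi> ((G * H) * germ_y * q) = 0"
        using q mult_in_O2[OF that H] by (auto simp: T_def)
      then show ?thesis by (simp add: ac_simps)
    qed
    then show "H \<otimes>\<^bsub>O2\<^esub> q \<in> T" "q \<otimes>\<^bsub>O2\<^esub> H \<in> T"
      using q H by (auto simp: T_def mult_in_O2 mult.commute[of q H])
  qed
  then have JT: "?J \<subseteq> T" by (rule genideal_minimal) (use F x y in \<open>auto simp: T_def\<close>)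
  have prod: "s \<in> carrier O2 \<and> \<phi> s = 0" if "s \<in> max_ideal \<cdot>\<^bsub>O2\<^esub> ?J" for s
    using that
  proof induction
    case (prod a q)
    obtain A B where AB: "A \<in> carrier O2" "B \<in> carrier O2" "a = germ_x * A + germ_y * B"
      using prod(1) by (rule max_ideal_decompose)
    have q: "q \<in> T" using prod JT by blast
    then have qc: "q \<in> carrier O2" by (simp add: T_def)
    have "a \<otimes>\<^bsub>O2\<^esub> q = A * germ_x * q + B * germ_y * q" by (simp add: AB(3) algebra_simps)
    moreover have "\<phi> (A * germ_x * q) = 0" "\<phi> (B * germ_y * q) = 0" using q AB by (auto simp: T_def)
    moreover have "A * germ_x * q \<in> carrier O2" "B * germ_y * q \<in> carrier O2" using AB qc by (auto intro!: O2_intros)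
    ultimately show ?case by (simp add: add add_in_O2)
  next
    case (sum s t)
    then show ?case by (simp add: add add_in_O2)
  qed
  obtain s G where "s \<in> max_ideal \<cdot>\<^bsub>O2\<^esub> ?J" "G \<in> carrier O2" "H = s + G * F"
    using H unfolding tjurina_ideal_1 set_add_def' cgenideal_def by auto
  with prod[of s] f[of G] F show ?thesis by (simp add: add mult_in_O2)
qed

section \<open>The two germs\<close>

lemma germ_power: "germ f ^ n = germ (\<lambda>p. f p ^ n)"
  by (induction n) (simp_all add: one_fgerm_def times_fgerm.abs_eq)

lemmas as_germ = germ_x_def germ_y_def const_germ.abs_eq germ_power times_fgerm.abs_eq
  plus_fgerm.abs_eq minus_fgerm.abs_eq uminus_fgerm.abs_eq

lemma taylor_coeff_scaled_monomial_mult: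
  assumes "G \<in> carrier O2"
  shows "taylor_coeff i j (const_germ c * (germ_x ^ a * germ_y ^ b * G)) =
    (if a \<le> i \<and> b \<le> j then c * taylor_coeff (i - a) (j - b) G else 0)"
  using assms by (simp add: taylor_coeff_const_mult taylor_coeff_monomial_mult O2_intros)

lemma taylor_coeff_monomial:
  "taylor_coeff i j (germ_x ^ a * germ_y ^ b) = (if i = a \<and> j = b then 1 else 0)"
  using taylor_coeff_monomial_mult[OF one_in_O2, of i j a b] taylor_coeff_const[of _ _ 1]
  by (auto simp: const_germ_1)

text \<open>Every remainder in \<open>taylor_expand\<close> is a multiple of a monomial at the end
  of its row, so the finite part represents F modulo \<open>I\<close> as soon as these monomials lie
  in \<open>I\<close>.\<close>

lemma staircase_remainder_in_ideal:
  assumes I: "ideal I O2" and F: "F \<in> carrier O2"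
    and n: "\<And>j. j < m \<Longrightarrow> germ_x ^ n j * germ_y ^ j \<in> I" and m: "germ_y ^ m \<in> I"
  shows "F - (\<Sum>j<m. \<Sum>i<n j. const_germ (taylor_coeff i j F) * (germ_x ^ i * germ_y ^ j)) \<in> I"
proof -
  obtain A B where A: "\<And>j. A j \<in> carrier O2" and B: "B \<in> carrier O2" and
    eq: "F = (\<Sum>j<m. ((\<Sum>i<n j. const_germ (taylor_coeff i j F) * germ_x ^ i) + germ_x ^ n j * A j) * germ_y ^ j)
      + B * germ_y ^ m"
    using taylor_expand[OF F] by blast
  let ?S = "\<Sum>j<m. \<Sum>i<n j. const_germ (taylor_coeff i j F) * (germ_x ^ i * germ_y ^ j)"
  let ?R = "(\<Sum>j<m. A j * (germ_x ^ n j * germ_y ^ j)) + B * germ_y ^ m"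
  have row: "((\<Sum>i<n j. const_germ (taylor_coeff i j F) * germ_x ^ i) + germ_x ^ n j * A j) * germ_y ^ j =
      A j * (germ_x ^ n j * germ_y ^ j) + (\<Sum>i<n j. const_germ (taylor_coeff i j F) * (germ_x ^ i * germ_y ^ j))" for j
    unfolding distrib_right sum_distrib_right by (simp only: ac_simps)
  have "F = (\<Sum>j<m. A j * (germ_x ^ n j * germ_y ^ j) +
      (\<Sum>i<n j. const_germ (taylor_coeff i j F) * (germ_x ^ i * germ_y ^ j))) + B * germ_y ^ m"
    using eq unfolding row .
  also have "\<dots> = ?R + ?S"
    unfolding sum.distrib by (simp only: ac_simps)
  finally have "F - ?S = ?R" unfolding diff_eq_eq .
  also have "\<dots> \<in> I"
  proof -
    have "(\<Sum>j\<in>T. A j * (germ_x ^ n j * germ_y ^ j)) \<in> I" if "finite T" "T \<subseteq> {..<m}" for T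
      using that by (induction T) (auto intro!: ideal_O2_closed[OF I] n A)
    then show ?thesis by (auto intro!: ideal_O2_closed[OF I] m B)
  qed
  finally show ?thesis .
qed

text \<open>The name is Arnold's: in the family of type E_12, with Milnor number 12, the monomial
  x^5 y carries the modulus.\<close>

abbreviation E12 :: fgerm where
  "E12 \<equiv> germ (\<lambda>(x, y). y ^ 3 - x ^ 7)"

abbreviation E12_deformed :: fgerm where
  "E12_deformed \<equiv> germ (\<lambda>(x, y). y ^ 3 - x ^ 7 + x ^ 5 * y)"

section \<open>Polynomial forms of the germs and their partial derivatives\<close>

lemma E12_eq: "E12 = germ_y ^ 3 - germ_x ^ 7"
  by (simp add: as_germ case_prod_unfold)

lemma partial_x_E12: "partial_x E12 = const_germ (-7) * germ_x ^ 6"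
proof -
  have "deriv (\<lambda>t. y ^ 3 - t ^ 7) x = -7 * x ^ 6" for x y :: complex
    by (rule DERIV_imp_deriv) (auto intro!: derivative_eq_intros)
  then show ?thesis by (simp add: partial_x.abs_eq as_germ case_prod_unfold)
qed

lemma partial_y_E12: "partial_y E12 = const_germ 3 * germ_y ^ 2"
proof -
  have "deriv (\<lambda>t. t ^ 3 - x ^ 7) y = 3 * y ^ 2" for x y :: complex
    by (rule DERIV_imp_deriv) (auto intro!: derivative_eq_intros)
  then show ?thesis by (simp add: partial_y.abs_eq as_germ case_prod_unfold)
qed

lemma E12_deformed_eq: "E12_deformed = germ_y ^ 3 - germ_x ^ 7 + germ_x ^ 5 * germ_y"
  by (simp add: as_germ case_prod_unfold)

lemma partial_x_E12_deformed:
  "partial_x E12_deformed = const_germ (-7) * germ_x ^ 6 + const_germ 5 * (germ_x ^ 4 * germ_y)"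
proof -
  have "deriv (\<lambda>t. y ^ 3 - t ^ 7 + t ^ 5 * y) x = -7 * x ^ 6 + 5 * (x ^ 4 * y)" for x y :: complex
    by (rule DERIV_imp_deriv) (auto intro!: derivative_eq_intros)
  then show ?thesis by (simp add: partial_x.abs_eq as_germ case_prod_unfold)
qed

lemma partial_y_E12_deformed:
  "partial_y E12_deformed = const_germ 3 * germ_y ^ 2 + germ_x ^ 5"
proof -
  have "deriv (\<lambda>t. t ^ 3 - x ^ 7 + x ^ 5 * t) y = 3 * y ^ 2 + x ^ 5" for x y :: complex
    by (rule DERIV_imp_deriv) (auto intro!: derivative_eq_intros)
  then show ?thesis by (simp add: partial_y.abs_eq as_germ case_prod_unfold)
qed

lemma E12_in_O2: "E12 \<in> carrier O2" "partial_x E12 \<in> carrier O2" "partial_y E12 \<in> carrier O2"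
  unfolding partial_x_E12 partial_y_E12 unfolding E12_eq by (intro O2_intros)+

lemma E12_deformed_in_O2: "E12_deformed \<in> carrier O2" "partial_x E12_deformed \<in> carrier O2"
    "partial_y E12_deformed \<in> carrier O2"
  unfolding partial_x_E12_deformed partial_y_E12_deformed unfolding E12_deformed_eq
  by (intro O2_intros)+

lemma germ_xy_in_max_ideal: "germ_x \<in> max_ideal" "germ_y \<in> max_ideal"
  by (simp_all add: max_ideal_def O2_intros)

lemma monomials_in_tjurina_ideal_E12:
  "germ_x ^ 7 \<in> tjurina_ideal 1 E12" "germ_x ^ 6 * germ_y \<in> tjurina_ideal 1 E12"
  "germ_x * germ_y ^ 2 \<in> tjurina_ideal 1 E12" "germ_y ^ 3 \<in> tjurina_ideal 1 E12"
proof -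
  let ?J = "tjurina_ideal 1 E12"
  note I = ideal_tjurina_ideal_1[OF E12_in_O2]
  note scale = ideal_O2_closed(5)[OF I _ const_in_O2]
  have xx: "germ_x * (const_germ (-7) * germ_x ^ 6) \<in> ?J" and yx: "germ_y * (const_germ (-7) * germ_x ^ 6) \<in> ?J"
    and xy: "germ_x * (const_germ 3 * germ_y ^ 2) \<in> ?J" and yy: "germ_y * (const_germ 3 * germ_y ^ 2) \<in> ?J"
    using tjurina_ideal_1_generators(2,3)[OF E12_in_O2] germ_xy_in_max_ideal
    by (simp_all only: partial_x_E12 partial_y_E12)
  have "germ_x ^ 7 = const_germ (-1/7) * (germ_x * (const_germ (-7) * germ_x ^ 6))"
    by (simp add: as_germ) (simp add: power_numeral_reduce mult_ac)
  also have "\<dots> \<in> ?J" by (rule scale[OF xx])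
  finally show "germ_x ^ 7 \<in> ?J" .
  have "germ_x ^ 6 * germ_y = const_germ (-1/7) * (germ_y * (const_germ (-7) * germ_x ^ 6))"
    by (simp add: as_germ mult_ac)
  also have "\<dots> \<in> ?J" by (rule scale[OF yx])
  finally show "germ_x ^ 6 * germ_y \<in> ?J" .
  have "germ_x * germ_y ^ 2 = const_germ (1/3) * (germ_x * (const_germ 3 * germ_y ^ 2))"
    by (simp add: as_germ)
  also have "\<dots> \<in> ?J" by (rule scale[OF xy])
  finally show "germ_x * germ_y ^ 2 \<in> ?J" .
  have "germ_y ^ 3 = const_germ (1/3) * (germ_y * (const_germ 3 * germ_y ^ 2))"
    by (simp add: as_germ power_numeral_reduce)
  also have "\<dots> \<in> ?J" by (rule scale[OF yy])
  finally show "germ_y ^ 3 \<in> ?J" .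
qed

text \<open>Everything rests on x^5 y: its coefficient in g - x g_x/7 - y g_y/3 is 1 - 5/7 - 1/3 =
  -1/21. With it x g_x yields x^7 and y g_y yields y^3, then x^2 g_y yields x^2 y^2. The last
  element is x g_y itself.\<close>

lemma monomials_in_tjurina_ideal_E12_deformed:
  "germ_x ^ 7 \<in> tjurina_ideal 1 E12_deformed" "germ_x ^ 5 * germ_y \<in> tjurina_ideal 1 E12_deformed"
  "germ_x ^ 2 * germ_y ^ 2 \<in> tjurina_ideal 1 E12_deformed" "germ_y ^ 3 \<in> tjurina_ideal 1 E12_deformed"
  "germ_x ^ 6 + const_germ 3 * (germ_x * germ_y ^ 2) \<in> tjurina_ideal 1 E12_deformed"
proof -
  let ?J = "tjurina_ideal 1 E12_deformed"
  note I = ideal_tjurina_ideal_1[OF E12_deformed_in_O2]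
  note scale = ideal_O2_closed(5)[OF I _ const_in_O2]
  note diff = ideal_O2_closed(4)[OF I]
  have g: "germ_y ^ 3 - germ_x ^ 7 + germ_x ^ 5 * germ_y \<in> ?J"
    using tjurina_ideal_1_generators(1)[OF E12_deformed_in_O2] by (simp only: E12_deformed_eq)
  have xx: "germ_x * (const_germ (-7) * germ_x ^ 6 + const_germ 5 * (germ_x ^ 4 * germ_y)) \<in> ?J"
    and xy: "germ_x * (const_germ 3 * germ_y ^ 2 + germ_x ^ 5) \<in> ?J"
    and yy: "germ_y * (const_germ 3 * germ_y ^ 2 + germ_x ^ 5) \<in> ?J"
    using tjurina_ideal_1_generators(2,3)[OF E12_deformed_in_O2] germ_xy_in_max_ideal
    by (simp_all only: partial_x_E12_deformed partial_y_E12_deformed)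
  \<comment> \<open>Euler relation: with weights \<open>1/7\<close> and \<open>1/3\<close> of \<open>x\<close> and \<open>y\<close>, the monomial \<open>x\<^sup>5y\<close> has weight
    \<open>1 + 1/21\<close>.\<close>
  have "germ_x ^ 5 * germ_y = const_germ (-21) * (germ_y ^ 3 - germ_x ^ 7 + germ_x ^ 5 * germ_y
     - const_germ (1/7) * (germ_x * (const_germ (-7) * germ_x ^ 6 + const_germ 5 * (germ_x ^ 4 * germ_y)))
     - const_germ (1/3) * (germ_y * (const_germ 3 * germ_y ^ 2 + germ_x ^ 5)))"
    unfolding as_germ by (rule arg_cong[of _ _ germ], rule ext) (simp add: field_simps power_numeral_reduce)
  also have "\<dots> \<in> ?J" by (rule scale[OF diff[OF diff[OF g scale[OF xx]] scale[OF yy]]])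
  finally show m1: "germ_x ^ 5 * germ_y \<in> ?J" .
  have "germ_x ^ 7 = const_germ (-1/7) * (germ_x * (const_germ (-7) * germ_x ^ 6 + const_germ 5 * (germ_x ^ 4 * germ_y))
      - const_germ 5 * (germ_x ^ 5 * germ_y))"
    unfolding as_germ by (rule arg_cong[of _ _ germ], rule ext) (simp add: field_simps power_numeral_reduce)
  also have "\<dots> \<in> ?J" by (rule scale[OF diff[OF xx scale[OF m1]]])
  finally show m2: "germ_x ^ 7 \<in> ?J" .
  have "germ_y ^ 3 = const_germ (1/3) * (germ_y * (const_germ 3 * germ_y ^ 2 + germ_x ^ 5) - germ_x ^ 5 * germ_y)"
    unfolding as_germ by (rule arg_cong[of _ _ germ], rule ext) (simp add: field_simps power_numeral_reduce)
  also have "\<dots> \<in> ?J" by (rule scale[OF diff[OF yy m1]])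
  finally show "germ_y ^ 3 \<in> ?J" .
  have "germ_x ^ 2 * germ_y ^ 2 =
      const_germ (1/3) * (germ_x * (germ_x * (const_germ 3 * germ_y ^ 2 + germ_x ^ 5)) - germ_x ^ 7)"
    unfolding as_germ by (rule arg_cong[of _ _ germ], rule ext) (simp add: field_simps power_numeral_reduce)
  also have "\<dots> \<in> ?J" by (rule scale[OF diff[OF ideal_O2_closed(5)[OF I xy germ_x_in_O2] m2]])
  finally show "germ_x ^ 2 * germ_y ^ 2 \<in> ?J" .
  have "germ_x ^ 6 + const_germ 3 * (germ_x * germ_y ^ 2) = germ_x * (const_germ 3 * germ_y ^ 2 + germ_x ^ 5)"
    unfolding as_germ by (rule arg_cong[of _ _ germ], rule ext) (simp add: field_simps power_numeral_reduce)
  then show "germ_x ^ 6 + const_germ 3 * (germ_x * germ_y ^ 2) \<in> ?J" using xy by simp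
qed

section \<open>Bases of the two quotients\<close>

lemma less_3_cases: "j < 3 \<longleftrightarrow> j = 0 \<or> j = 1 \<or> j = (2::nat)"
  by auto

lemma tjurina_E12: "tjurina 1 E12 = 14"
proof -
  \<comment> \<open>\<open>n j\<close> is the least exponent for which x^(n j) y^j lies in the
    ideal, and 7 + 6 + 1 = 14. Index pairs put the exponent of y first because the range of i
    depends on j.\<close>
  define n where "n = (\<lambda>j::nat. if j = 0 then 7 else if j = 1 then 6 else 1 :: nat)"
  let ?S = "SIGMA j:{..<3}. {..<n j}"
  let ?b = "\<lambda>(j, i). germ_x ^ i * germ_y ^ j"
  let ?\<phi> = "\<lambda>(j, i). taylor_coeff i j"
  note I = ideal_tjurina_ideal_1[OF E12_in_O2]
  note tc = taylor_coeff_scaled_monomial_mult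
  have "quotient_dim (tjurina_ideal 1 E12) = enat (card ?S)"
  proof (rule quotient_dim_eq_card[OF I, where b = ?b and \<phi> = ?\<phi>])
    show "finite ?S" by simp
    have "(0, 0) \<in> ?S" by (simp add: n_def)
    then show "?S \<noteq> {}" by blast
    fix s H assume "s \<in> ?S" "H \<in> tjurina_ideal 1 E12"
    then obtain j i where s: "s = (j, i)" and ji: "j = 0 \<and> i < 7 \<or> j = 1 \<and> i < 6 \<or> j = 2 \<and> i < 1"
      by (auto simp: n_def less_3_cases)
    have "taylor_coeff i j H = 0"
    proof (rule vanish_on_tjurina_ideal_1[OF E12_in_O2 _ _ _ _ _ _ \<open>H \<in> _\<close>])
      fix G assume G: "G \<in> carrier O2"
      have "G * germ_x * partial_x E12 = const_germ (-7) * (germ_x ^ 7 * germ_y ^ 0 * G)"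
        unfolding partial_x_E12 by (simp add: power_numeral_reduce ac_simps)
      then show "taylor_coeff i j (G * germ_x * partial_x E12) = 0" using ji by (simp only: tc[OF G]) auto
      have "G * germ_y * partial_x E12 = const_germ (-7) * (germ_x ^ 6 * germ_y ^ 1 * G)"
        unfolding partial_x_E12 by (simp add: ac_simps)
      then show "taylor_coeff i j (G * germ_y * partial_x E12) = 0" using ji by (simp only: tc[OF G]) auto
      have "G * germ_x * partial_y E12 = const_germ 3 * (germ_x ^ 1 * germ_y ^ 2 * G)"
        unfolding partial_y_E12 by (simp add: ac_simps)
      then show "taylor_coeff i j (G * germ_x * partial_y E12) = 0" using ji by (simp only: tc[OF G]) auto
      have "G * germ_y * partial_y E12 = const_germ 3 * (germ_x ^ 0 * germ_y ^ 3 * G)"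
        unfolding partial_y_E12 by (simp add: power_numeral_reduce ac_simps)
      then show "taylor_coeff i j (G * germ_y * partial_y E12) = 0" using ji by (simp only: tc[OF G]) auto
      have "G * E12 = const_germ 1 * (germ_x ^ 0 * germ_y ^ 3 * G) + const_germ (-1) * (germ_x ^ 7 * germ_y ^ 0 * G)"
        unfolding E12_eq by (simp add: const_germ_1 const_germ_minus algebra_simps)
      moreover have "taylor_coeff i j (const_germ 1 * (germ_x ^ 0 * germ_y ^ 3 * G) +
          const_germ (-1) * (germ_x ^ 7 * germ_y ^ 0 * G)) = 0"
        using ji by (simp only: taylor_coeff_add tc[OF G] O2_intros G) auto
      ultimately show "taylor_coeff i j (G * E12) = 0" by (simp only:)
    qed (rule taylor_coeff_add)
    then show "?\<phi> s H = 0" by (simp add: s)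
  next
    fix F assume F: "F \<in> carrier O2"
    have "(\<Sum>s\<in>?S. const_germ (?\<phi> s F) * ?b s) =
        (\<Sum>j<3. \<Sum>i<n j. const_germ (taylor_coeff i j F) * (germ_x ^ i * germ_y ^ j))"
      by (subst sum.Sigma) (auto simp: case_prod_unfold)
    moreover have "F - (\<Sum>j<3. \<Sum>i<n j. const_germ (taylor_coeff i j F) * (germ_x ^ i * germ_y ^ j)) \<in> tjurina_ideal 1 E12"
      by (rule staircase_remainder_in_ideal[OF I F])
        (use monomials_in_tjurina_ideal_E12 in \<open>auto simp: n_def less_3_cases\<close>)
    ultimately show "F - (\<Sum>s\<in>?S. const_germ (?\<phi> s F) * ?b s) \<in> tjurina_ideal 1 E12" by simp
  qed (auto simp: taylor_coeff_add taylor_coeff_const_mult taylor_coeff_monomial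
      split: if_splits intro!: O2_intros)
  moreover have "card ?S = 14" by (simp add: n_def eval_nat_numeral)
  ultimately show ?thesis by (simp add: tjurina_def numeral_eq_enat)
qed

lemma tjurina_E12_deformed: "tjurina 1 E12_deformed = 13"
proof -
  \<comment> \<open>The count is 6 + 5 + 2 = 13. Row 0 stops before x^6, which is not in the ideal
    but is represented by x y^2.\<close>
  define n where "n = (\<lambda>j::nat. if j = 0 then 6 else if j = 1 then 5 else 2 :: nat)"
  let ?S = "SIGMA j:{..<3}. {..<n j}"
  let ?b = "\<lambda>(j, i). germ_x ^ i * germ_y ^ j"
  \<comment> \<open>Modulo the ideal \<open>x\<^sup>6 = -3xy\<^sup>2\<close>, so \<open>x\<^sup>6\<close> contributes to the coordinate of \<open>xy\<^sup>2\<close>.\<close>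
  let ?\<phi> = "\<lambda>(j, i) F. taylor_coeff i j F - (if j = 2 \<and> i = 1 then 3 * taylor_coeff 6 0 F else 0)"
  let ?J = "tjurina_ideal 1 E12_deformed"
  note I = ideal_tjurina_ideal_1[OF E12_deformed_in_O2]
  note tc = taylor_coeff_scaled_monomial_mult
  have "quotient_dim ?J = enat (card ?S)"
  proof (rule quotient_dim_eq_card[OF I, where b = ?b and \<phi> = ?\<phi>])
    show "finite ?S" by simp
    have "(0, 0) \<in> ?S" by (simp add: n_def)
    then show "?S \<noteq> {}" by blast
    fix s H assume "s \<in> ?S" "H \<in> ?J"
    then obtain j i where s: "s = (j, i)" and ji: "j = 0 \<and> i < 6 \<or> j = 1 \<and> i < 5 \<or> j = 2 \<and> i < 2"
      by (auto simp: n_def less_3_cases)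
    have "?\<phi> (j, i) H = 0"
    proof (rule vanish_on_tjurina_ideal_1[OF E12_deformed_in_O2 _ _ _ _ _ _ \<open>H \<in> _\<close>])
      fix G assume G: "G \<in> carrier O2"
      note tc2 = taylor_coeff_add tc[OF G] O2_intros G
      have "G * germ_x * partial_x E12_deformed =
          const_germ (-7) * (germ_x ^ 7 * germ_y ^ 0 * G) + const_germ 5 * (germ_x ^ 5 * germ_y ^ 1 * G)"
        unfolding partial_x_E12_deformed by (simp add: power_numeral_reduce algebra_simps)
      then show "?\<phi> (j, i) (G * germ_x * partial_x E12_deformed) = 0" using ji by (simp only: tc2 case_prod_conv) auto
      have "G * germ_y * partial_x E12_deformed =
          const_germ (-7) * (germ_x ^ 6 * germ_y ^ 1 * G) + const_germ 5 * (germ_x ^ 4 * germ_y ^ 2 * G)"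
        unfolding partial_x_E12_deformed by (simp add: power_numeral_reduce algebra_simps)
      then show "?\<phi> (j, i) (G * germ_y * partial_x E12_deformed) = 0" using ji by (simp only: tc2 case_prod_conv) auto
      \<comment> \<open>At x y^2 the two terms of x g_y contribute 3 G(0) and -3 G(0) to the
        corrected form; this cancellation fixes the factor 3.\<close>
      have "G * germ_x * partial_y E12_deformed =
          const_germ 3 * (germ_x ^ 1 * germ_y ^ 2 * G) + const_germ 1 * (germ_x ^ 6 * germ_y ^ 0 * G)"
        unfolding partial_y_E12_deformed by (simp add: power_numeral_reduce const_germ_1 algebra_simps)
      then show "?\<phi> (j, i) (G * germ_x * partial_y E12_deformed) = 0" using ji by (simp only: tc2 case_prod_conv) auto
      have "G * germ_y * partial_y E12_deformed =
          const_germ 3 * (germ_x ^ 0 * germ_y ^ 3 * G) + const_germ 1 * (germ_x ^ 5 * germ_y ^ 1 * G)"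
        unfolding partial_y_E12_deformed by (simp add: power_numeral_reduce const_germ_1 algebra_simps)
      then show "?\<phi> (j, i) (G * germ_y * partial_y E12_deformed) = 0" using ji by (simp only: tc2 case_prod_conv) auto
      have "G * E12_deformed = const_germ 1 * (germ_x ^ 0 * germ_y ^ 3 * G) +
          const_germ (-1) * (germ_x ^ 7 * germ_y ^ 0 * G) + const_germ 1 * (germ_x ^ 5 * germ_y ^ 1 * G)"
        unfolding E12_deformed_eq by (simp add: const_germ_1 const_germ_minus algebra_simps)
      then show "?\<phi> (j, i) (G * E12_deformed) = 0" using ji by (simp only: tc2 case_prod_conv) auto
    qed (simp add: taylor_coeff_add)
    then show "?\<phi> s H = 0" by (simp add: s)
  next
    fix F assume F: "F \<in> carrier O2"
    \<comment> \<open>Row 0 first runs up to x^6, since x^7 is the first pure power of x in the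
      ideal. Adding the multiple \<open>?c\<close> of x^6 + 3 x y^2 then trades the x^6 term for a
      correction at x y^2.\<close>
    define n' where "n' = (\<lambda>j::nat. if j = 0 then 7 else if j = 1 then 5 else 2 :: nat)"
    let ?c = "const_germ (taylor_coeff 6 0 F)"
    let ?R = "F - (\<Sum>j<3. \<Sum>i<n' j. const_germ (taylor_coeff i j F) * (germ_x ^ i * germ_y ^ j))"
    have "?R \<in> ?J"
      by (rule staircase_remainder_in_ideal[OF I F])
        (use monomials_in_tjurina_ideal_E12_deformed in \<open>auto simp: n'_def less_3_cases\<close>)
    moreover have "?c * (germ_x ^ 6 + const_germ 3 * (germ_x * germ_y ^ 2)) \<in> ?J"
      by (rule ideal_O2_closed(5)[OF I monomials_in_tjurina_ideal_E12_deformed(5) const_in_O2])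
    ultimately have "?R + ?c * (germ_x ^ 6 + const_germ 3 * (germ_x * germ_y ^ 2)) \<in> ?J"
      by (rule ideal_O2_closed(3)[OF I])
    moreover have "(\<Sum>s\<in>?S. const_germ (?\<phi> s F) * ?b s) =
        (\<Sum>j<3. \<Sum>i<n j. const_germ (?\<phi> (j, i) F) * (germ_x ^ i * germ_y ^ j))"
      by (subst sum.Sigma) (auto simp: case_prod_unfold)
    moreover have "?R + ?c * (germ_x ^ 6 + const_germ 3 * (germ_x * germ_y ^ 2)) =
        F - (\<Sum>j<3. \<Sum>i<n j. const_germ (?\<phi> (j, i) F) * (germ_x ^ i * germ_y ^ j))"
    proof -
      have 3: "{..<3} = {0, 1, 2::nat}" by auto
      have 7: "{..<7::nat} = insert 6 {..<6}" and 2: "{..<2::nat} = {0, 1}" by auto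
      have c: "const_germ (a - 3 * b) = const_germ a - const_germ 3 * const_germ b" for a b
        by transfer simp
      show ?thesis by (simp add: 3 7 2 n_def n'_def c algebra_simps)
    qed
    ultimately show "F - (\<Sum>s\<in>?S. const_germ (?\<phi> s F) * ?b s) \<in> ?J" by simp
  next
    fix s F G assume "F \<in> carrier O2" "G \<in> carrier O2"
    then show "?\<phi> s (F + G) = ?\<phi> s F + ?\<phi> s G"
      by (cases s) (simp add: taylor_coeff_add)
  next
    fix s c F assume "F \<in> carrier O2"
    then show "?\<phi> s (const_germ c * F) = c * ?\<phi> s F"
      by (cases s) (simp add: taylor_coeff_const_mult right_diff_distrib)
  next
    fix s t assume "s \<in> ?S" "t \<in> ?S"
    moreover obtain j i l k where s: "s = (j, i)" and t: "t = (l, k)" by (cases s; cases t)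
    \<comment> \<open>The correction reads only the coefficient of x^6, which is not a basis
      monomial, so duality is unaffected.\<close>
    ultimately have "\<not> (6 = k \<and> 0 = l)" by (auto simp: n_def split: if_splits)
    then show "?\<phi> s (?b t) = (if s = t then 1 else 0)"
      unfolding s t case_prod_conv taylor_coeff_monomial by auto
  qed (auto intro!: O2_intros)
  moreover have "card ?S = 13" by (simp add: n_def eval_nat_numeral)
  ultimately show ?thesis by (simp add: tjurina_def numeral_eq_enat)
qed

section \<open>Isolated singularities and conclusion\<close>

lemma isolated_singularity_E12: "isolated_singularity E12"
proof -
  have "E12 \<in> max_ideal"
    using E12_in_O2(1) by (simp add: max_ideal_def value0.abs_eq case_prod_unfold)
  moreover have "eventually (\<lambda>p. \<not> (-7 * fst p ^ 6 = 0 \<and> 3 * snd p ^ 2 = 0)) (at (0 :: complex \<times> complex))"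
    by (auto simp: eventually_at_filter prod_eq_iff)
  then have "isolated_common_zero (partial_x E12) (partial_y E12)"
    unfolding partial_x_E12 partial_y_E12 by (simp add: as_germ isolated_common_zero.abs_eq)
  ultimately show ?thesis unfolding isolated_singularity_def by blast
qed

text \<open>For x nonzero, g_x = 0 gives y = 7x^2/5, and then g_y = 0 gives x = -147/25. This second
  critical point lies outside the unit ball.\<close>

lemma isolated_singularity_E12_deformed: "isolated_singularity E12_deformed"
proof -
  have "E12_deformed \<in> max_ideal"
    using E12_deformed_in_O2(1) by (simp add: max_ideal_def value0.abs_eq case_prod_unfold)
  moreover have "eventually (\<lambda>p. \<not> (-7 * fst p ^ 6 + 5 * (fst p ^ 4 * snd p) = 0 \<and> 3 * snd p ^ 2 + fst p ^ 5 = 0))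
      (at (0 :: complex \<times> complex))"
  proof -
    have "eventually (\<lambda>p. p \<in> ball 0 1) (nhds (0 :: complex \<times> complex))"
      by (rule eventually_nhds_in_open) auto
    then show ?thesis
      unfolding eventually_at_filter
    proof (rule eventually_mono, intro impI notI)
      fix p :: "complex \<times> complex"
      assume p: "p \<in> ball 0 1" "p \<noteq> 0"
      assume "- 7 * fst p ^ 6 + 5 * (fst p ^ 4 * snd p) = 0 \<and> 3 * snd p ^ 2 + fst p ^ 5 = 0"
      moreover obtain x y where xy: "p = (x, y)" by (cases p)
      ultimately have e: "- 7 * x ^ 6 + 5 * (x ^ 4 * y) = 0" "3 * y ^ 2 + x ^ 5 = 0" by auto
      show False
      proof (cases "x = 0")
        case True
        then show False using e p by (auto simp: xy zero_prod_def)
      next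
        case False
        have "x ^ 4 * (5 * y - 7 * x ^ 2) = 0" using e(1) by (simp add: algebra_simps flip: power_add)
        then have "5 * y = 7 * x ^ 2" using False by simp
        then have y: "y = 7 / 5 * x ^ 2" by (simp add: field_simps)
        have "x ^ 4 * (147 / 25 + x) = 3 * y ^ 2 + x ^ 5"
          unfolding y by (simp add: field_simps power_numeral_reduce)
        then have "147 / 25 + x = 0" using e(2) False by simp
        then have "x = - (147 / 25)" by (simp add: eq_neg_iff_add_eq_0 add.commute)
        then have "norm x = 147 / 25" by simp
        moreover have "norm x < 1" using p(1) norm_fst_le[of x y] by (simp add: xy)
        ultimately show False by simp
      qed
    qed
  qed
  then have "isolated_common_zero (partial_x E12_deformed) (partial_y E12_deformed)"
    unfolding partial_x_E12_deformed partial_y_E12_deformed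
    by (simp add: as_germ isolated_common_zero.abs_eq)
  ultimately show ?thesis unfolding isolated_singularity_def by blast
qed

theorem mainTheorem4:
  fixes f g :: "complex \<times> complex \<Rightarrow> complex"
  defines "f \<equiv> (\<lambda>(x, y). y ^ 3 - x ^ 7)"
    and "g \<equiv> (\<lambda>(x, y). y ^ 3 - x ^ 7 + x ^ 5 * y)"
  shows "\<not> topological_invariant (tjurina 1)
    \<and> isolated_singularity (germ f) \<and> isolated_singularity (germ g)
    \<and> topologically_equivalent (germ f) (germ g)
    \<and> tjurina 1 (germ f) = 14 \<and> tjurina 1 (germ g) = 13"
proof -
  have "topologically_equivalent (germ f) (germ g)"
    unfolding f_def g_def topologically_equivalent.abs_eq by (rule zero_sets_homeomorphic_E12)
  moreover note isolated_singularity_E12[folded f_def] isolated_singularity_E12_deformed[folded g_def]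
    tjurina_E12[folded f_def] tjurina_E12_deformed[folded g_def]
  moreover from this have "tjurina 1 (germ f) \<noteq> tjurina 1 (germ g)" by simp
  ultimately show ?thesis unfolding topological_invariant_def by blast
qed

end
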